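(* Let $N\in\mathcal{LC}$ with $\mu(N)>0$ and let $0<r<\mu(N)$. Assume that there exists $C\ge1$ such that for all integers $k\ge1$ $$\frac{(\nu_{2k})^{1/r}}{(\nu_k)^{1/r}}\le C+C\,\frac{(\nu_{2k})^{1/r}}{2k}\sum_{j\ge2k}\frac{1}{(\nu_j)^{1/r}}.$$ Then there exists $L\in\mathcal{LC}$ satisfying (mg) such that for each $0<\gamma<r$ the following holds: there exists a constant $k_1>0$ such that for every $h>0$ there is a linear and continuous map $$E^{L,N}_h:\ \Lambda_{\widehat{L},h}\to\mathcal{A}_{\widehat{N},k_1h}(S_\gamma),\qquad a\mapsto f_a,$$ with $\mathcal{B}(f_a)=a$ for all $a\in\Lambda_{\widehat{L},h}$, where $\widehat{L}=(p!L_p)_{p\in\mathbb{N}}$ and $\widehat{N}=(p!N_p)_{p\in\mathbb{N}}$. Thus $\mathcal{B}(\mathcal{A}_{\{\widehat{N}\}}(S_\gamma))\supseteq\Lambda_{\{\widehat{L}\}}$. Moreover, $L$ is maximal (up to a constant) among those $M\in\mathcal{LC}$ satisfying $\mu_k\le C'\nu_k$ for some $C'\ge 1$ and all $k$, and $(M,N)_{\gamma_r}$: writing $\lambda_k$ for the quotients of $L$, $L$ itself has these properties, and for every such $M$ there is $D\ge1$ with $\mu_k\le D\lambda_k$ for all $k\in\mathbb{N}$.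
   Context: $\mathbb{N}=\{0,1,2,\dots\}$. For a sequence $M=(M_k)_{k\in\mathbb{N}}$ of positive reals put $\mu_0:=1$, $\mu_k:=M_k/M_{k-1}$ for $k\ge1$ (the quotients of $M$); $\nu_k$, $\lambda_k$ denote the quotients of $N$, $L$. $\mathcal{LC}$ is the set of all sequences $M$ of positive reals that are normalized ($1=M_0\le M_1$), log-convex ($M_j^2\le M_{j-1}M_{j+1}$ for all $j\ge1$) and satisfy $\lim_{k\to\infty}(M_k)^{1/k}=+\infty$. $M$ satisfies (mg) if there is $C\ge1$ with $M_{j+k}\le C^{j+k}M_jM_k$ for all $j,k\in\mathbb{N}$. Order of quasianalyticity: $\mu(N):=\sup\left\{r>0:\sum_{k\ge1}\left(\frac1{\nu_k}\right)^{1/r}<+\infty\right\}\in[0,+\infty]$ ($0$ if there is no such $r$). Condition $(M,N)_{\gamma_r}$: $\sup_{p\ge1}\frac{(\mu_p)^{1/r}}{p}\sum_{k\ge p}\left(\frac{1}{\nu_k}\right)^{1/r}<+\infty$. Let $\mathcal{R}$ be the Riemann surface of the logarithm and $S_\gamma:=\{z\in\mathcal{R}:|\arg(z)|<\gamma\pi/2\}$. For a sequence $M$ of positive reals, $h>0$ and a sector $S$, $\mathcal{A}_{M,h}(S)$ is the Banach space of holomorphic $f$ on $S$ with $\|f\|_{M,h}:=\sup_{z\in S,p\in\mathbb{N}}\frac{|f^{(p)}(z)|}{h^pM_p}<\infty$, and $\Lambda_{M,h}$ is the Banach space of complex sequences $a$ with $|a|_{M,h}:=\sup_{p\in\mathbb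 N}\frac{|a_p|}{h^pM_p}<\infty$; $\mathcal{A}_{\{M\}}(S):=\bigcup_{h>0}\mathcal{A}_{M,h}(S)$, $\Lambda_{\{M\}}:=\bigcup_{h>0}\Lambda_{M,h}$. The Borel map is $\mathcal{B}(f):=(f^{(p)}(0))_{p\in\mathbb{N}}$ with $f^{(p)}(0):=\lim_{z\in S,\,z\to0}f^{(p)}(z)$. *)

theory Defs
  imports "HOL-Complex_Analysis.Complex_Analysis"
begin

subsection \<open>Weight sequences\<close>

definition quot :: "(nat \<Rightarrow> real) \<Rightarrow> nat \<Rightarrow> real" where
  "quot M k = (if k = 0 then 1 else M k / M (k - 1))"

definition LC :: "(nat \<Rightarrow> real) set" where
  "LC = {M. (\<forall>k. M k > 0) \<and> M 0 = 1 \<and> 1 \<le> M 1 \<and>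
            (\<forall>j\<ge>1. (M j)\<^sup>2 \<le> M (j - 1) * M (j + 1)) \<and>
            filterlim (\<lambda>k. M k powr (1 / real k)) at_top sequentially}"

definition mg :: "(nat \<Rightarrow> real) \<Rightarrow> bool" where
  "mg M \<longleftrightarrow> (\<exists>C\<ge>1. \<forall>j k. M (j + k) \<le> C ^ (j + k) * M j * M k)"

text \<open>The supremum is taken in \<^typ>\<open>ennreal\<close>, where \<^term>\<open>Sup {} = (0::ennreal)\<close>.\<close>

definition quasianalyticity_order :: "(nat \<Rightarrow> real) \<Rightarrow> ennreal" where
  "quasianalyticity_order N =
     Sup (ennreal ` {r. r > 0 \<and> summable (\<lambda>k. (1 / quot N (Suc k)) powr (1 / r))})"

text \<open>The condition $(M,N)_{\gamma_r}$. Convergence of the series is part of the requirement that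
  the supremum be finite; sums over $k \ge p$ are written by shifting the index.\<close>

definition gamma_cond :: "(nat \<Rightarrow> real) \<Rightarrow> (nat \<Rightarrow> real) \<Rightarrow> real \<Rightarrow> bool" where
  "gamma_cond M N r \<longleftrightarrow>
     (\<forall>p\<ge>1. summable (\<lambda>k. (1 / quot N (k + p)) powr (1 / r))) \<and>
     bdd_above ((\<lambda>p. quot M p powr (1 / r) / real p *
                     (\<Sum>k. (1 / quot N (k + p)) powr (1 / r))) ` {1..})"

definition hat :: "(nat \<Rightarrow> real) \<Rightarrow> nat \<Rightarrow> real" where
  "hat M p = fact p * M p"


subsection \<open>Sectors on the Riemann surface of the logarithm\<close>

text \<open>The logarithm is a global biholomorphic chart of the Riemann surface \<open>R\<close> of the logarithm
  onto the complex plane. We represent a point \<open>z\<close> of \<open>R\<close> by \<open>w = log z\<close>, so the projection of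
  \<open>z\<close> to the punctured plane is \<open>exp w\<close>, \<open>arg z = Im w\<close> and \<open>|z| = exp (Re w)\<close>; no bound on the
  opening of a sector is needed. A function on a sector is holomorphic iff it is holomorphic in \<open>w\<close>,
  and by the chain rule \<open>d/dz = exp (- w) d/dw\<close>.\<close>

type_synonym rlog = complex

definition sector :: "real \<Rightarrow> rlog set" where
  "sector \<gamma> = {w. \<bar>Im w\<bar> < \<gamma> * pi / 2}"

definition rlog_deriv :: "(rlog \<Rightarrow> complex) \<Rightarrow> rlog \<Rightarrow> complex" where
  "rlog_deriv f w = deriv f w / exp w"

text \<open>The filter describing \<open>z \<rightarrow> 0\<close> with \<open>z\<close> in the sector.\<close>

definition sector_at_0 :: "real \<Rightarrow> rlog filter" where
  "sector_at_0 \<gamma> = inf (filtercomap exp (nhds 0)) (principal (sector \<gamma>))"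

lemma open_sector: "open (sector \<gamma>)"
  unfolding sector_def by (intro open_Collect_less continuous_intros)

text \<open>On functions that factor through the projection, the iterated derivatives are the usual
  ones.\<close>

lemma rlog_deriv_exp:
  assumes g: "g holomorphic_on U" and U: "open U" and w: "exp w \<in> U"
  shows "(rlog_deriv ^^ n) (\<lambda>w. g (exp w)) w = (deriv ^^ n) g (exp w)"
  using w
proof (induction n arbitrary: w)
  case (Suc n)
  let ?V = "exp -` U :: complex set"
  have V: "open ?V"
    by (intro open_vimage U continuous_intros)
  have "deriv ((rlog_deriv ^^ n) (\<lambda>w. g (exp w))) w = deriv (\<lambda>w. (deriv ^^ n) g (exp w)) w"
    by (intro deriv_cong_ev refl eventually_mono[OF eventually_nhds_in_open[OF V]])
       (use Suc in auto)
  also have "((\<lambda>w. (deriv ^^ n) g (exp w)) has_field_derivative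
               deriv ((deriv ^^ n) g) (exp w) * exp w) (at w)"
    by (rule DERIV_chain2[OF holomorphic_derivI[OF holomorphic_higher_deriv[OF g U] U Suc.prems]
          DERIV_exp])
  then have "deriv (\<lambda>w. (deriv ^^ n) g (exp w)) w = deriv ((deriv ^^ n) g) (exp w) * exp w"
    by (rule DERIV_imp_deriv)
  finally show ?case
    by (simp add: rlog_deriv_def[of "(rlog_deriv ^^ n) _"])
qed simp

lemma sector_at_0_neq_bot:
  assumes "\<gamma> > 0"
  shows "sector_at_0 \<gamma> \<noteq> bot"
proof -
  have "filterlim complex_of_real (sector_at_0 \<gamma>) at_bot"
    unfolding sector_at_0_def
  proof (intro filterlim_inf[THEN iffD2] conjI filterlim_principal[THEN iffD2])
    have "((\<lambda>x. complex_of_real (exp x)) \<longlongrightarrow> of_real 0) at_bot"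
      by (intro tendsto_of_real exp_at_bot)
    then show "filterlim complex_of_real (filtercomap exp (nhds 0)) at_bot"
      by (simp add: filterlim_filtercomap_iff o_def exp_of_real)
  qed (use assms in \<open>simp add: sector_def\<close>)
  then show ?thesis
    by (metis filterlim_def filtermap_bot_iff le_bot trivial_limit_at_bot_linorder)
qed


subsection \<open>Weighted spaces and the Borel map\<close>

text \<open>Elements of the function space are total functions; only their values on the sector matter.
  The norms are meaningful for members of the respective spaces.\<close>

definition ultra_space :: "(nat \<Rightarrow> real) \<Rightarrow> real \<Rightarrow> rlog set \<Rightarrow> (rlog \<Rightarrow> complex) set" where
  "ultra_space M h S =
     {f. f holomorphic_on S \<and>
         bdd_above ((\<lambda>(w, p). norm ((rlog_deriv ^^ p) f w) / (h ^ p * M p)) ` (S \<times> UNIV))}"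

definition ultra_norm :: "(nat \<Rightarrow> real) \<Rightarrow> real \<Rightarrow> rlog set \<Rightarrow> (rlog \<Rightarrow> complex) \<Rightarrow> real" where
  "ultra_norm M h S f = (SUP (w, p)\<in>S \<times> UNIV. norm ((rlog_deriv ^^ p) f w) / (h ^ p * M p))"

definition ultra_union :: "(nat \<Rightarrow> real) \<Rightarrow> rlog set \<Rightarrow> (rlog \<Rightarrow> complex) set" where
  "ultra_union M S = (\<Union>h\<in>{0<..}. ultra_space M h S)"

definition Lambda_space :: "(nat \<Rightarrow> real) \<Rightarrow> real \<Rightarrow> (nat \<Rightarrow> complex) set" where
  "Lambda_space M h = {a. bdd_above (range (\<lambda>p. norm (a p) / (h ^ p * M p)))}"

definition Lambda_norm :: "(nat \<Rightarrow> real) \<Rightarrow> real \<Rightarrow> (nat \<Rightarrow> complex) \<Rightarrow> real" where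
  "Lambda_norm M h a = (SUP p. norm (a p) / (h ^ p * M p))"

definition Lambda_union :: "(nat \<Rightarrow> real) \<Rightarrow> (nat \<Rightarrow> complex) set" where
  "Lambda_union M = (\<Union>h\<in>{0<..}. Lambda_space M h)"

text \<open>\<open>has_borel_image \<gamma> f a\<close> says that all the limits defining the Borel map exist on the sector
  and that its value at \<open>f\<close> is \<open>a\<close>.\<close>

definition has_borel_image :: "real \<Rightarrow> (rlog \<Rightarrow> complex) \<Rightarrow> (nat \<Rightarrow> complex) \<Rightarrow> bool" where
  "has_borel_image \<gamma> f a \<longleftrightarrow> (\<forall>p. ((rlog_deriv ^^ p) f \<longlongrightarrow> a p) (sector_at_0 \<gamma>))"

definition borel_map :: "real \<Rightarrow> (rlog \<Rightarrow> complex) \<Rightarrow> nat \<Rightarrow> complex" where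
  "borel_map \<gamma> f = (\<lambda>p. Lim (sector_at_0 \<gamma>) ((rlog_deriv ^^ p) f))"

lemma borel_map_eqI:
  assumes "\<gamma> > 0" "has_borel_image \<gamma> f a"
  shows "borel_map \<gamma> f = a"
  using assms sector_at_0_neq_bot[of \<gamma>]
  by (auto simp: borel_map_def has_borel_image_def intro!: tendsto_Lim)

text \<open>Complex-linear continuous maps from \<open>Lambda_space M h\<close> to \<open>ultra_space M' h' S\<close>, equality of
  functions being equality on \<open>S\<close>.\<close>

definition linear_continuous ::
  "(nat \<Rightarrow> real) \<Rightarrow> real \<Rightarrow> (nat \<Rightarrow> real) \<Rightarrow> real \<Rightarrow> rlog set \<Rightarrow>
   ((nat \<Rightarrow> complex) \<Rightarrow> rlog \<Rightarrow> complex) \<Rightarrow> bool" where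
  "linear_continuous M h M' h' S E \<longleftrightarrow>
     (\<forall>a\<in>Lambda_space M h. E a \<in> ultra_space M' h' S) \<and>
     (\<forall>a\<in>Lambda_space M h. \<forall>b\<in>Lambda_space M h. \<forall>w\<in>S.
        E (\<lambda>p. a p + b p) w = E a w + E b w) \<and>
     (\<forall>c. \<forall>a\<in>Lambda_space M h. \<forall>w\<in>S. E (\<lambda>p. c * a p) w = c * E a w) \<and>
     (\<forall>a\<in>Lambda_space M h. \<forall>\<epsilon>>0. \<exists>\<delta>>0. \<forall>b\<in>Lambda_space M h.
        Lambda_norm M h (\<lambda>p. b p - a p) < \<delta> \<longrightarrow>
        ultra_norm M' h' S (\<lambda>w. E b w - E a w) < \<epsilon>)"

end

theory Submission
  imports Defs "HOL-Real_Asymp.Real_Asymp"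
begin

text \<open>The idea. Put $m_k = \nu_k^{1/r}$, so that $\sum_k 1/m_k$ converges. The two conditions on a competing
  sequence \<open>M\<close>, domination of its quotients by those of \<open>N\<close> and $(M,N)_{\gamma_r}$, say that $\mu_k^{1/r}$ is at most a
  constant times $m_k$ and at most a constant times $k / \sum_{j \ge k} 1/m_j$.
  With $\tau_k = k/m_k + \sum_{j \ge k} 1/m_j$ they amount to $\mu_k^{1/r} \le D\, k/\tau_k$. The maximal sequence
  therefore has the quotients $\lambda_k = (\tau_1 k/\tau_k)^r$. It is log-convex because $\tau$ decreases, and
  the growth hypothesis on \<open>N\<close> yields $\tau_k \le (C + 1)\, \tau_{2k}$, that is, the doubling of $\lambda$ and
  hence (mg).

  The extension is constructed on the full sector of opening \<open>r\<close>, from the single kernel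
  $\kappa(t) = \left((1 + t^{1/r})^2 \prod_{j \ge 1} (1 + t^{1/r}/m_j)\right)^{-r}$. Since $t^{1/r}$ lies in the
  right half-plane, each factor of the product is at least $\max(1, |t|^{1/r}/m_j)$ in modulus; hence
  $|\kappa(t)| \le 4 N_n |t|^{-n} (1 + |t|)^{-2}$ for every \<open>n\<close>. On the other hand, the moments
  $c_p = \int_0^\infty \kappa(t)\, t^p\, dt$ are at least $L_p$ up to a geometric factor, by
  evaluation near $t = \lambda_{p+1}$ (\<open>cutoffs_exist\<close>). This loses a factor $\lambda_{p+1}$, which is at most
  geometric in \<open>p\<close> by (mg).

  The truncated Laplace transform with this kernel is the series
  $f_a(z) = \sum_p \frac{a_p}{p!\, c_p}\, z^p\, \Phi_p(R/z)$ with $\Phi_p(t) = \int_0^t \kappa(u)\, u^p\, du$. Both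
  $\Phi_p$ and $c_p - \Phi_p$ obey the bound $4 N_n |t|^{p-n}$, the former for $n \le p$ and the latter
  for $n > p$ (\<open>cutoff_exists\<close>), which is precisely the estimate of the Taylor remainders of $f_a$
  required by the weight \<open>N\<close>. Cauchy's inequality on a smaller sector gives the derivatives
  (\<open>sector_Cauchy_estimate\<close>, \<open>extension_operator\<close>).\<close>

section \<open>Logarithms of canonical products\<close>

lemma norm_Ln_one_plus_le:
  assumes "Re w \<ge> 0"
  shows "norm (Ln (1 + w)) \<le> norm w"
proof -
  have "norm (Ln (1 + w) - Ln (1 + 0)) \<le> 1 * norm (w - 0)"
  proof (rule field_differentiable_bound[where S = "{w. Re w \<ge> 0}" and f = "\<lambda>w. Ln (1 + w)" and f' = "\<lambda>w. 1 / (1 + w)"])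
    fix z :: complex assume z: "z \<in> {w. Re w \<ge> 0}"
    then have nz: "1 + z \<notin> \<real>\<^sub>\<le>\<^sub>0"
      by (auto simp: complex_nonpos_Reals_iff)
    show "((\<lambda>w. Ln (1 + w)) has_field_derivative 1 / (1 + z)) (at z within {w. Re w \<ge> 0})"
      using nz by (auto intro!: derivative_eq_intros simp: field_simps)
    have "1 \<le> Re (1 + z)" using z by simp
    also have "\<dots> \<le> norm (1 + z)" by (rule complex_Re_le_cmod)
    finally show "norm (1 / (1 + z)) \<le> 1" by (auto simp: norm_divide divide_le_eq_1)
  qed (use assms in \<open>auto simp: convex_halfspace_Re_ge\<close>)
  then show ?thesis by simp
qed

text \<open>The logarithm of the canonical product $\prod_j (1 + b_j w)$ for a summable positive sequence $b$,
  as a sum of principal logarithms. In the right half-plane all factors stay off the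
  branch cut.\<close>
definition log_prod :: "(nat \<Rightarrow> real) \<Rightarrow> complex \<Rightarrow> complex" where
  "log_prod b w = (\<Sum>j. Ln (1 + w * of_real (b j)))"

lemma summable_log_prod:
  assumes b: "\<And>j. b j > 0" "summable b" and w: "Re w \<ge> 0"
  shows "summable (\<lambda>j. Ln (1 + w * of_real (b j)))"
proof (rule summable_norm_cancel, rule summable_comparison_test'[where N = 0])
  show "summable (\<lambda>j. norm w * b j)" using b by (intro summable_mult)
  fix n
  show "norm (norm (Ln (1 + w * of_real (b n)))) \<le> norm w * b n"
    using norm_Ln_one_plus_le[of "w * of_real (b n)"] w b(1)[of n]
    by (simp add: norm_mult)
qed

lemma holomorphic_log_prod:
  assumes b: "\<And>j. b j > 0" "summable b"
  shows "log_prod b holomorphic_on {w. Re w > 0}"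
proof (rule holomorphic_uniform_sequence[where f = "\<lambda>n w. \<Sum>j<n. Ln (1 + w * of_real (b j))"])
  show "open {w. Re w > 0}" by (rule open_halfspace_Re_gt)
  show "(\<lambda>w. \<Sum>j<n. Ln (1 + w * of_real (b j))) holomorphic_on {w. Re w > 0}" for n
  proof (intro holomorphic_intros)
    fix j and w :: complex assume "w \<in> {w. Re w > 0}"
    then have "Re (1 + w * of_real (b j)) > 0"
      using b(1)[of j] by (simp add: add_pos_pos)
    then show "1 + w * of_real (b j) \<notin> \<real>\<^sub>\<le>\<^sub>0" by (auto simp: complex_nonpos_Reals_iff)
  qed
  fix x :: complex assume x: "x \<in> {w. Re w > 0}"
  obtain d where d: "d > 0" "cball x d \<subseteq> {w. Re w > 0}"
    using open_contains_cball[of "{w. Re w > 0}"] open_halfspace_Re_gt[of 0] x by auto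
  have "uniform_limit (cball x d) (\<lambda>n w. \<Sum>j<n. Ln (1 + w * of_real (b j))) (\<lambda>w. \<Sum>j. Ln (1 + w * of_real (b j))) sequentially"
  proof (rule Weierstrass_m_test)
    show "summable (\<lambda>j. (norm x + d) * b j)" using b by (intro summable_mult)
    fix n w assume w: "w \<in> cball x d"
    then have "norm w \<le> norm x + d"
      using norm_triangle_ineq2[of w x] by (simp add: dist_norm norm_minus_commute)
    moreover have "Re w > 0" using d w by auto
    ultimately show "norm (Ln (1 + w * of_real (b n))) \<le> (norm x + d) * b n"
      using norm_Ln_one_plus_le[of "w * of_real (b n)"] b(1)[of n]
      by (simp add: norm_mult) (smt (verit) mult_right_mono)
  qed
  then show "\<exists>d>0. cball x d \<subseteq> {w. Re w > 0} \<and>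
      uniform_limit (cball x d) (\<lambda>n w. \<Sum>j<n. Ln (1 + w * of_real (b j))) (log_prod b) sequentially"
    using d by (auto simp: log_prod_def[abs_def])
qed

text \<open>In the right half-plane each factor satisfies $|1 + b_j w| \ge \max(1, b_j |w|)$, so the product
  dominates every finite product of the numbers $b_j |w|$.\<close>
lemma Re_log_prod_ge:
  assumes b: "\<And>j. b j > 0" "summable b" and w: "Re w > 0"
  shows "(\<Sum>j<n. ln (norm w * b j)) \<le> Re (log_prod b w)"
proof -
  have ge: "max 0 (ln (norm w * b j)) \<le> Re (Ln (1 + w * of_real (b j)))" for j
  proof -
    have b0: "b j > 0" by (rule b)
    have w0: "w \<noteq> 0" using w by auto
    have Re1: "1 \<le> Re (1 + w * of_real (b j))" using w b0 by simp
    then have ne: "1 + w * of_real (b j) \<noteq> 0" by (metis not_one_le_zero zero_complex.simps(1))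
    have 1: "1 \<le> norm (1 + w * of_real (b j))"
      using Re1 complex_Re_le_cmod order_trans by blast
    have "norm (w * of_real (b j)) \<le> norm (1 + w * of_real (b j))"
      unfolding cmod_def using w b0 by (intro real_sqrt_le_mono) (simp add: power2_eq_square algebra_simps)
    then have "ln (norm w * b j) \<le> ln (norm (1 + w * of_real (b j)))"
      using b0 w0 by (intro ln_mono) (auto simp: norm_mult)
    then show ?thesis using 1 ne by simp
  qed
  have sm: "summable (\<lambda>j. Re (Ln (1 + w * of_real (b j))))"
    using summable_log_prod[OF b, of w] w by (intro summable_Re) auto
  have "(\<Sum>j<n. ln (norm w * b j)) \<le> (\<Sum>j<n. Re (Ln (1 + w * of_real (b j))))"
    using ge by (intro sum_mono) (auto simp del: Re_Ln)
  also have "\<dots> \<le> (\<Sum>j. Re (Ln (1 + w * of_real (b j))))"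
    using ge by (intro sum_le_suminf sm) (auto simp del: Re_Ln)
  also have "\<dots> = Re (log_prod b w)"
    unfolding log_prod_def using summable_log_prod[OF b, of w] w by (subst Re_suminf) auto
  finally show ?thesis .
qed

lemma summable_ln_one_plus:
  assumes b: "\<And>j. b j > (0::real)" "summable b" and x: "x > 0"
  shows "summable (\<lambda>j. ln (1 + x * b j))"
proof (rule summable_comparison_test'[where N = 0])
  show "summable (\<lambda>j. x * b j)" using b by (intro summable_mult)
  fix n show "norm (ln (1 + x * b n)) \<le> x * b n"
    using b(1)[of n] x ln_add_one_self_le_self[of "x * b n"] by simp
qed

lemma log_prod_of_real:
  assumes b: "\<And>j. b j > 0" "summable b" and x: "x > 0"
  shows "log_prod b (of_real x) = of_real (\<Sum>j. ln (1 + x * b j))"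
proof -
  have "Ln (1 + of_real x * of_real (b j)) = of_real (ln (1 + x * b j))" for j
    using b(1)[of j] x Ln_of_real[of "1 + x * b j"] by (simp add: add_pos_pos)
  then show ?thesis
    unfolding log_prod_def using summable_ln_one_plus[OF b x] by (simp add: suminf_of_real)
qed

text \<open>On the positive axis the product is controlled from above: the factors beyond the first \<open>n\<close>
  contribute at most the exponential of \<open>x\<close> times the tail of the series.\<close>
lemma suminf_ln_one_plus_le:
  fixes b :: "nat \<Rightarrow> real"
  assumes b: "\<And>j. b j > 0" "summable b" and x: "x > 0"
  shows "(\<Sum>j. ln (1 + x * b j)) \<le> (\<Sum>j<n. ln (1 + x * b j)) + x * (\<Sum>j. b (j + n))"
proof -
  have sm: "summable (\<lambda>j. ln (1 + x * b j))" by (rule summable_ln_one_plus[OF b x])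
  have "(\<Sum>j. ln (1 + x * b j)) = (\<Sum>j. ln (1 + x * b (j + n))) + (\<Sum>j<n. ln (1 + x * b j))"
    by (rule suminf_split_initial_segment[OF sm])
  also have "(\<Sum>j. ln (1 + x * b (j + n))) \<le> (\<Sum>j. x * b (j + n))"
  proof (rule suminf_le)
    show "ln (1 + x * b (j + n)) \<le> x * b (j + n)" for j
      using b(1)[of "j+n"] x ln_add_one_self_le_self[of "x * b (j+n)"] by simp
    show "summable (\<lambda>j. ln (1 + x * b (j + n)))"
      using sm summable_ignore_initial_segment by blast
    show "summable (\<lambda>j. x * b (j + n))"
      using b(2) by (intro summable_mult summable_ignore_initial_segment)
  qed
  also have "(\<Sum>j. x * b (j + n)) = x * (\<Sum>j. b (j + n))"
    using b(2) by (intro suminf_mult summable_ignore_initial_segment)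
  finally show ?thesis by simp
qed

lemma suminf_ln_one_plus_mono:
  fixes b :: "nat \<Rightarrow> real"
  assumes b: "\<And>j. b j > 0" "summable b" and x: "0 < x" "x \<le> y"
  shows "(\<Sum>j. ln (1 + x * b j)) \<le> (\<Sum>j. ln (1 + y * b j))"
proof (rule suminf_le)
  show "ln (1 + x * b j) \<le> ln (1 + y * b j)" for j
    using b(1)[of j] x by (intro ln_mono) (auto intro!: add_pos_pos mult_right_mono)
qed (use x in \<open>auto intro!: summable_ln_one_plus b\<close>)

section \<open>Cut-off functions with prescribed decay\<close>

lemma convergent_if_dist_le:
  fixes X :: "nat \<Rightarrow> complex" and \<psi> :: "nat \<Rightarrow> real"
  assumes conv: "convergent \<psi>" and le: "\<And>m n. m \<le> n \<Longrightarrow> norm (X n - X m) \<le> \<bar>\<psi> n - \<psi> m\<bar>"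
  shows "convergent X"
proof -
  have C: "Cauchy \<psi>" using conv by (rule convergent_Cauchy)
  have le': "norm (X m - X n) \<le> norm (\<psi> m - \<psi> n)" for m n
    using le[of m n] le[of n m] by (cases "m \<le> n") (auto simp: norm_minus_commute abs_minus_commute)
  have "Cauchy X"
  proof (rule CauchyI)
    fix e :: real assume "e > 0"
    then obtain M where "\<forall>m\<ge>M. \<forall>n\<ge>M. norm (\<psi> m - \<psi> n) < e"
      using CauchyD[OF C] by blast
    then show "\<exists>M. \<forall>m\<ge>M. \<forall>n\<ge>M. norm (X m - X n) < e"
      using le' by (meson order_le_less_trans)
  qed
  then show ?thesis by (simp add: Cauchy_convergent)
qed

lemma convex_sector: "convex (sector \<gamma>)"
proof -
  have "sector \<gamma> = {w. Im w < \<gamma> * pi / 2} \<inter> {w. Im w > - (\<gamma> * pi / 2)}"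
    by (auto simp: sector_def)
  then show ?thesis
    using convex_Int[OF convex_halfspace_Im_lt convex_halfspace_Im_gt] by metis
qed

lemma of_real_in_sector [simp]: "of_real x \<in> sector \<gamma> \<longleftrightarrow> \<gamma> > 0"
  by (simp add: sector_def zero_less_mult_iff)

lemma Complex_in_sector: "Complex x y \<in> sector \<gamma> \<longleftrightarrow> \<bar>y\<bar> < \<gamma> * pi / 2"
  by (simp add: sector_def)

text \<open>From a kernel to a cut-off. In the logarithmic coordinate \<open>s = log t\<close>, the function
  \<open>\<Phi>\<close> is $\int_0^t \kappa(u)\, u^p\, du$ and \<open>m\<close> is the full moment $\int_0^\infty \kappa(u)\, u^p\, du$; no
  rotation of the path is needed because \<open>\<Phi>\<close> is a primitive on the strip. The kernel being bounded by
  $D_n |t|^{-n} (1 + |t|)^{-2}$ for all \<open>n\<close> at once, both \<open>\<Phi>\<close> (for $n \le p$) and its distance to the moment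
  (for $n > p$) are at most $D_n |t|^{p - n}$. The last clause bounds the moment from below by the part
  of the integral over one unit interval of the logarithmic axis, where the kernel is positive and
  decreasing.\<close>
lemma cutoff_exists:
  fixes \<kappa> :: "complex \<Rightarrow> complex" and k :: "real \<Rightarrow> real" and D :: "nat \<Rightarrow> real"
  assumes r: "r > 0" and hol: "\<kappa> holomorphic_on sector r" and D: "\<And>n. D n > 0"
    and bound: "\<And>n s. s \<in> sector r \<Longrightarrow>
      norm (\<kappa> s) \<le> D n * exp (- real n * Re s) / (1 + exp (Re s))\<^sup>2"
    and real: "\<And>x. \<kappa> (of_real x) = of_real (k x)" and pos: "\<And>x. k x > 0"
    and anti: "\<And>x y. x \<le> y \<Longrightarrow> k y \<le> k x"
  shows "\<exists>\<Phi> m. \<Phi> holomorphic_on sector r \<and>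
     (\<forall>n s. n \<le> p \<longrightarrow> s \<in> sector r \<longrightarrow> norm (\<Phi> s) \<le> D n * exp ((real p - real n) * Re s)) \<and>
     (\<forall>n s. p < n \<longrightarrow> s \<in> sector r \<longrightarrow> norm (m - \<Phi> s) \<le> D n * exp ((real p - real n) * Re s)) \<and>
     (\<forall>x. exp ((x - 1) * (real p + 1)) * k x \<le> norm m)"
proof -
  define f where "f s = \<kappa> s * exp ((of_nat p + 1) * s)" for s
  have "f holomorphic_on sector r"
    unfolding f_def by (intro holomorphic_intros hol)
  then obtain F where F': "\<And>s. s \<in> sector r \<Longrightarrow> (F has_field_derivative f s) (at s within sector r)"
    using holomorphic_convex_primitive'[OF convex_sector open_sector] by blast
  then have F: "(F has_field_derivative f s) (at s)" if "s \<in> sector r" for s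
    using that at_within_open[OF that open_sector] by metis
  have nf: "norm (f s) \<le> D n * exp ((real p - real n) * Re s) * exp (Re s) / (1 + exp (Re s))\<^sup>2"
    if "s \<in> sector r" for s n
  proof -
    have "norm (f s) = norm (\<kappa> s) * exp ((real p + 1) * Re s)"
      by (simp add: f_def norm_mult algebra_simps)
    also have "\<dots> \<le> D n * exp (- real n * Re s) / (1 + exp (Re s))\<^sup>2 * exp ((real p + 1) * Re s)"
      using bound[OF that] by (intro mult_right_mono) auto
    also have "\<dots> = D n * exp ((real p - real n) * Re s) * exp (Re s) / (1 + exp (Re s))\<^sup>2"
      by (simp add: exp_add[symmetric] algebra_simps)
    finally show ?thesis .
  qed
  \<comment> \<open>Increments along horizontal lines: any real antiderivative of the bound for \<open>f\<close> controls them.\<close>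
  have hor: "norm (F (Complex v y) - F (Complex u y)) \<le> \<phi> v - \<phi> u"
    if y: "\<bar>y\<bar> < r * pi / 2" and uv: "u \<le> v"
      and \<phi>: "\<And>x. (\<phi> has_real_derivative \<phi>' x) (at x)"
      and le: "\<And>x. D n * exp ((real p - real n) * x) * exp x / (1 + exp x)\<^sup>2 \<le> \<phi>' x"
    for u v y n \<phi> \<phi>'
  proof (cases "u = v")
    case False
    have der: "((\<lambda>x. F (Complex x y)) has_vector_derivative f (Complex x y)) (at x)" for x
    proof -
      have "((\<lambda>z. F (z + of_real y * \<i>)) has_field_derivative f (Complex x y)) (at (of_real x))"
        using F[of "Complex x y", unfolded Complex_in_sector, OF y]
        by (subst DERIV_shift[symmetric]) (simp add: Complex_eq mult.commute)
      then have "((\<lambda>x. F (of_real x + of_real y * \<i>)) has_vector_derivative f (Complex x y)) (at x)"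
        by (rule has_vector_derivative_real_field)
      then show ?thesis by (simp add: Complex_eq mult.commute)
    qed
    show ?thesis
    proof (rule differentiable_bound_general[of u v "\<lambda>x. F (Complex x y)" \<phi> "\<lambda>x. f (Complex x y)" \<phi>'])
      show "continuous_on {u..v} (\<lambda>x. F (Complex x y))"
        using der by (intro continuous_at_imp_continuous_on) (auto intro: has_vector_derivative_continuous)
      show "continuous_on {u..v} \<phi>"
        using \<phi> by (intro continuous_at_imp_continuous_on) (auto intro: DERIV_isCont)
      show "norm (f (Complex x y)) \<le> \<phi>' x" for x
        using nf[of "Complex x y" n] le[of x] y by (auto simp: Complex_in_sector intro: order_trans)
    qed (use uv False der \<phi> in \<open>auto simp: has_real_derivative_iff_has_vector_derivative\<close>)
  qed simp
  \<comment> \<open>The factor \<open>exp x / (1 + exp x)\<^sup>2\<close> has the antiderivatives \<open>1 - 1 / (1 + exp x)\<close>, vanishing at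
      \<open>-\<infinity>\<close>, and \<open>- 1 / (1 + exp x)\<close>, vanishing at \<open>\<infinity>\<close>. Multiplying the former by an increasing and
      the latter by a decreasing exponential keeps the derivative above the bound for \<open>f\<close>.\<close>
  define \<phi>1 where "\<phi>1 n x = D n * exp ((real p - real n) * x) * (1 - 1 / (1 + exp x))" for n x
  define \<phi>2 where "\<phi>2 n x = - (D n * exp ((real p - real n) * x) * (1 / (1 + exp x)))" for n x
  have e0: "1 + exp x \<noteq> 0" "1 + exp x > 0" for x :: real using exp_gt_zero[of x] by linarith+
  have dlogistic': "((\<lambda>x. 1 / (1 + exp x)) has_real_derivative - (exp x / (1 + exp x)\<^sup>2)) (at x)" for x :: real
    using e0[of x] by (auto intro!: derivative_eq_intros simp: power2_eq_square)
  have dlogistic: "((\<lambda>x. 1 - 1 / (1 + exp x)) has_real_derivative exp x / (1 + exp x)\<^sup>2) (at x)" for x :: real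
    using DERIV_diff[OF DERIV_const[of 1] dlogistic'] by simp
  have dexp: "((\<lambda>x. D n * exp ((real p - real n) * x)) has_real_derivative
      (real p - real n) * (D n * exp ((real p - real n) * x))) (at x)" for n x
    by (auto intro!: derivative_eq_intros)
  have hor1: "norm (F (Complex v y) - F (Complex u y)) \<le> \<phi>1 n v - \<phi>1 n u"
    if "\<bar>y\<bar> < r * pi / 2" "u \<le> v" "n \<le> p" for u v y n
  proof (rule hor[OF that(1,2)])
    fix x
    show "(\<phi>1 n has_real_derivative
        D n * exp ((real p - real n) * x) * exp x / (1 + exp x)\<^sup>2
        + (real p - real n) * (D n * exp ((real p - real n) * x) * (1 - 1 / (1 + exp x)))) (at x)"
      unfolding \<phi>1_def by (rule DERIV_cong[OF DERIV_mult[OF dexp dlogistic]]) (simp add: mult_ac)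
    have "0 \<le> 1 - 1 / (1 + exp x)" using e0[of x] by (simp add: field_simps)
    then have "0 \<le> (real p - real n) * (D n * exp ((real p - real n) * x) * (1 - 1 / (1 + exp x)))"
      using D[of n] that(3) by (intro mult_nonneg_nonneg) auto
    then show "D n * exp ((real p - real n) * x) * exp x / (1 + exp x)\<^sup>2 \<le>
        D n * exp ((real p - real n) * x) * exp x / (1 + exp x)\<^sup>2
        + (real p - real n) * (D n * exp ((real p - real n) * x) * (1 - 1 / (1 + exp x)))"
      by simp
  qed
  have hor2: "norm (F (Complex v y) - F (Complex u y)) \<le> \<phi>2 n v - \<phi>2 n u"
    if "\<bar>y\<bar> < r * pi / 2" "u \<le> v" "p < n" for u v y n
  proof (rule hor[OF that(1,2)])
    fix x
    show "(\<phi>2 n has_real_derivative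
        D n * exp ((real p - real n) * x) * exp x / (1 + exp x)\<^sup>2
        + (real n - real p) * (D n * exp ((real p - real n) * x) / (1 + exp x))) (at x)"
      unfolding \<phi>2_def
      by (rule DERIV_cong[OF DERIV_minus[OF DERIV_mult[OF dexp dlogistic']]])
         (simp add: divide_inverse algebra_simps)
    have "0 \<le> (real n - real p) * (D n * exp ((real p - real n) * x) / (1 + exp x))"
      using D[of n] that(3) e0[of x] by (intro mult_nonneg_nonneg divide_nonneg_nonneg) auto
    then show "D n * exp ((real p - real n) * x) * exp x / (1 + exp x)\<^sup>2 \<le>
        D n * exp ((real p - real n) * x) * exp x / (1 + exp x)\<^sup>2
        + (real n - real p) * (D n * exp ((real p - real n) * x) / (1 + exp x))"
      by simp
  qed
  \<comment> \<open>Vertical increments; for \<open>n = 0\<close> and for \<open>n = p + 1\<close> the bound tends to \<open>0\<close> at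
      \<open>-\<infinity>\<close> and at \<open>\<infinity>\<close>, respectively.\<close>
  have ver: "norm (F (Complex x y) - F (of_real x)) \<le>
      D n * exp ((real p - real n) * x) * exp x / (1 + exp x)\<^sup>2 * \<bar>y\<bar>"
    if "\<bar>y\<bar> < r * pi / 2" for x y n
  proof -
    have sub: "closed_segment (of_real x) (Complex x y) \<subseteq> sector r"
      using that r by (intro closed_segment_subset convex_sector) (auto simp: Complex_in_sector)
    have Rex: "Re s = x" if "s \<in> closed_segment (of_real x) (Complex x y)" for s
      using that by (auto simp: closed_segment_def left_diff_distrib)
    have "norm (F (Complex x y) - F (of_real x)) \<le>
      D n * exp ((real p - real n) * x) * exp x / (1 + exp x)\<^sup>2 * norm (Complex x y - of_real x)"
    proof (rule field_differentiable_bound[where S = "closed_segment (of_real x) (Complex x y)" and f' = f])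
      fix z assume z: "z \<in> closed_segment (of_real x) (Complex x y)"
      then show "(F has_field_derivative f z) (at z within closed_segment (complex_of_real x) (Complex x y))"
        using F sub by (blast intro: has_field_derivative_at_within)
      show "norm (f z) \<le> D n * exp ((real p - real n) * x) * exp x / (1 + exp x)\<^sup>2"
        using nf[of z n] z sub Rex[OF z] by auto
    qed auto
    also have "norm (Complex x y - of_real x) = \<bar>y\<bar>" by (simp add: cmod_def)
    finally show ?thesis .
  qed
  have reals: "norm (F (of_real v) - F (of_real u)) \<le> \<phi>1 p v - \<phi>1 p u" if "u \<le> v" for u v
    using hor1[of 0 u v p] that r by (simp add: complex_of_real_def)
  \<comment> \<open>The limits of the primitive at the two ends of the strip.\<close>
  have "convergent (\<lambda>j. F (of_real (- real j)))"
  proof (rule convergent_if_dist_le)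
    have "(\<lambda>j. \<phi>1 p (- real j)) \<longlonglongrightarrow> 0" unfolding \<phi>1_def by simp real_asymp
    then show "convergent (\<lambda>j. \<phi>1 p (- real j))" by (rule convergentI)
    fix m n :: nat assume "m \<le> n"
    then show "norm (F (of_real (- real n)) - F (of_real (- real m))) \<le> \<bar>\<phi>1 p (- real n) - \<phi>1 p (- real m)\<bar>"
      using reals[of "- real n" "- real m"] by (simp add: norm_minus_commute)
  qed
  then obtain c where c: "(\<lambda>j. F (of_real (- real j))) \<longlonglongrightarrow> c" by (auto simp: convergent_def)
  have "convergent (\<lambda>j. F (of_real (real j)))"
  proof (rule convergent_if_dist_le)
    have "(\<lambda>j. \<phi>1 p (real j)) \<longlonglongrightarrow> D p" unfolding \<phi>1_def by simp real_asymp
    then show "convergent (\<lambda>j. \<phi>1 p (real j))" by (rule convergentI)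
    fix m n :: nat assume "m \<le> n"
    then show "norm (F (of_real (real n)) - F (of_real (real m))) \<le> \<bar>\<phi>1 p (real n) - \<phi>1 p (real m)\<bar>"
      using reals[of "real m" "real n"] by simp
  qed
  then obtain d where d: "(\<lambda>j. F (of_real (real j))) \<longlonglongrightarrow> d" by (auto simp: convergent_def)
  have lower: "norm (F s - c) \<le> D n * exp ((real p - real n) * Re s)"
    if s: "s \<in> sector r" and n: "n \<le> p" for s n
  proof -
    obtain x y where xy: "s = Complex x y" by (cases s)
    with s have y: "\<bar>y\<bar> < r * pi / 2" by (simp add: Complex_in_sector)
    let ?B = "\<lambda>j. \<phi>1 n x + D 0 * exp (- real j) * \<bar>y\<bar>"
    have "norm (F s - c) \<le> \<phi>1 n x"
    proof (rule tendsto_le[OF trivial_limit_sequentially])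
      show "?B \<longlonglongrightarrow> \<phi>1 n x" by real_asymp
      show "(\<lambda>j. norm (F s - F (of_real (- real j)))) \<longlonglongrightarrow> norm (F s - c)"
        by (intro tendsto_intros c)
      have step: "norm (F s - F (of_real (- real j))) \<le> ?B j" if j: "- real j \<le> x" for j
      proof -
        have "norm (F s - F (of_real (- real j))) \<le> norm (F s - F (Complex (- real j) y))
            + norm (F (Complex (- real j) y) - F (of_real (- real j)))"
          by norm
        moreover have "norm (F s - F (Complex (- real j) y)) \<le> \<phi>1 n x - \<phi>1 n (- real j)"
          unfolding xy by (rule hor1[OF y j n])
        moreover have "\<phi>1 n (- real j) \<ge> 0"
          unfolding \<phi>1_def using D[of n] e0[of "- real j"] by (intro mult_nonneg_nonneg) (auto simp: field_simps)
        moreover have "norm (F (Complex (- real j) y) - F (of_real (- real j))) \<le> D 0 * exp (- real j) * \<bar>y\<bar>"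
        proof -
          have 1: "exp (- (real p * real j)) \<le> 1" by simp
          have 2: "1 \<le> (1 + exp (- real j))\<^sup>2" by (intro one_le_power) auto
          have "D 0 * exp ((real p - real 0) * - real j) * exp (- real j) / (1 + exp (- real j))\<^sup>2
             \<le> D 0 * 1 * exp (- real j) / 1"
            using 1 2 D[of 0] by (intro frac_le mult_mono) (auto intro: less_imp_le)
          then show ?thesis
            using ver[OF y, of "- real j" 0] 
            by (smt (verit) abs_ge_zero mult_right_mono div_by_1 mult.right_neutral)
        qed
        ultimately show ?thesis by linarith
      qed
      show "eventually (\<lambda>j. norm (F s - F (of_real (- real j))) \<le> ?B j) sequentially"
        using eventually_ge_at_top[of "nat \<lceil>-x\<rceil>"] by (elim eventually_mono) (rule step; linarith)
    qed
    also have "\<phi>1 n x \<le> D n * exp ((real p - real n) * x) * 1"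
      unfolding \<phi>1_def using D[of n] e0[of x] by (intro mult_left_mono) (auto intro: less_imp_le)
    finally show ?thesis by (simp add: xy)
  qed
  have upper: "norm (d - F s) \<le> D n * exp ((real p - real n) * Re s)"
    if s: "s \<in> sector r" and n: "p < n" for s n
  proof -
    obtain x y where xy: "s = Complex x y" by (cases s)
    with s have y: "\<bar>y\<bar> < r * pi / 2" by (simp add: Complex_in_sector)
    let ?B = "\<lambda>j. - \<phi>2 n x + D (Suc p) / (1 + exp (real j))\<^sup>2 * \<bar>y\<bar>"
    have "norm (d - F s) \<le> - \<phi>2 n x"
    proof (rule tendsto_le[OF trivial_limit_sequentially])
      show "?B \<longlonglongrightarrow> - \<phi>2 n x" by real_asymp
      show "(\<lambda>j. norm (F (of_real (real j)) - F s)) \<longlonglongrightarrow> norm (d - F s)"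
        by (intro tendsto_intros d)
      have step: "norm (F (of_real (real j)) - F s) \<le> ?B j" if j: "x \<le> real j" for j
      proof -
        have "norm (F (of_real (real j)) - F s) \<le> norm (F (Complex (real j) y) - F s)
            + norm (F (Complex (real j) y) - F (of_real (real j)))"
          by norm
        moreover have "norm (F (Complex (real j) y) - F s) \<le> \<phi>2 n (real j) - \<phi>2 n x"
          unfolding xy by (rule hor2[OF y j n])
        moreover have "\<phi>2 n (real j) \<le> 0"
          unfolding \<phi>2_def using D[of n] e0[of "real j"] by (simp add: less_imp_le)
        moreover have "norm (F (Complex (real j) y) - F (of_real (real j))) \<le> D (Suc p) / (1 + exp (real j))\<^sup>2 * \<bar>y\<bar>"
          using ver[OF y, of "real j" "Suc p"] by (simp add: exp_minus field_simps)
        ultimately show ?thesis by linarith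
      qed
      show "eventually (\<lambda>j. norm (F (of_real (real j)) - F s) \<le> ?B j) sequentially"
        using eventually_ge_at_top[of "nat \<lceil>x\<rceil>"] by (elim eventually_mono) (rule step; linarith)
    qed
    also have "- \<phi>2 n x \<le> D n * exp ((real p - real n) * x) / 1"
      unfolding \<phi>2_def using D[of n] e0[of x] by (auto simp: field_simps mult_left_le)
    finally show ?thesis by (simp add: xy)
  qed
  have mass: "exp ((x - 1) * (real p + 1)) * k x \<le> norm (d - c)" for x
  proof -
    have der: "((\<lambda>x. Re (F (of_real x))) has_real_derivative k x * exp ((real p + 1) * x)) (at x)" for x
    proof -
      have "((\<lambda>x. F (of_real x)) has_vector_derivative f (of_real x)) (at x)"
        using F[of "of_real x"] r by (intro has_vector_derivative_real_field) auto
      moreover have "f (of_real x) = of_real (k x * exp ((real p + 1) * x))"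
        by (simp add: f_def real exp_of_real[symmetric])
      ultimately show ?thesis
        using bounded_linear.has_vector_derivative[OF bounded_linear_Re]
        by (fastforce simp: has_real_derivative_iff_has_vector_derivative)
    qed
    have mono: "Re (F (of_real u)) \<le> Re (F (of_real v))" if "u \<le> v" for u v
      by (rule DERIV_nonneg_imp_nondecreasing[OF that]) (use der pos in \<open>force intro: less_imp_le\<close>)
    have "\<exists>z>x-1. z < x \<and> Re (F (of_real x)) - Re (F (of_real (x-1))) = (x - (x-1)) * (k z * exp ((real p + 1) * z))"
      using der by (intro MVT2) auto
    then obtain z where z: "x - 1 < z" "z < x"
      and eq: "Re (F (of_real x)) - Re (F (of_real (x-1))) = k z * exp ((real p + 1) * z)" by auto
    have "exp ((x - 1) * (real p + 1)) * k x \<le> exp ((real p + 1) * z) * k z"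
      using z anti[of z x] pos[of x] by (intro mult_mono) (auto simp: mult.commute intro: less_imp_le)
    also have "\<dots> = Re (F (of_real x)) - Re (F (of_real (x-1)))" using eq by simp
    also have "\<dots> \<le> Re d - Re c"
    proof (rule tendsto_le[OF trivial_limit_sequentially])
      show "(\<lambda>j. Re (F (of_real (real j))) - Re (F (of_real (- real j)))) \<longlonglongrightarrow> Re d - Re c"
        by (intro tendsto_intros c d)
      have step: "Re (F (of_real x)) - Re (F (of_real (x-1))) \<le> Re (F (of_real (real j))) - Re (F (of_real (- real j)))"
        if "x \<le> real j" "- real j \<le> x - 1" for j
        using mono[OF that(1)] mono[OF that(2)] by simp
      show "eventually (\<lambda>j. Re (F (of_real x)) - Re (F (of_real (x-1))) \<le> Re (F (of_real (real j))) - Re (F (of_real (- real j)))) sequentially"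
        using eventually_ge_at_top[of "nat \<lceil>\<bar>x\<bar> + 1\<rceil>"] by (elim eventually_mono) (rule step; linarith)
    qed (rule tendsto_const)
    also have "\<dots> \<le> norm (d - c)" using complex_Re_le_cmod[of "d - c"] by simp
    finally show ?thesis .
  qed
  have "F holomorphic_on sector r"
    using F' by (auto simp: holomorphic_on_def field_differentiable_def)
  then have "(\<lambda>s. F s - c) holomorphic_on sector r" by (intro holomorphic_intros)
  then show ?thesis
    using lower upper mass by (intro exI[of _ "\<lambda>s. F s - c"] exI[of _ "d - c"]) auto
qed

section \<open>Derivatives and Cauchy estimates on sectors\<close>

text \<open>The iterated derivative in the variable of the surface depends only on the germ of the function.\<close>
lemma higher_rlog_deriv_cong_ev:
  assumes "eventually (\<lambda>x. f x = g x) (nhds w)"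
  shows "(rlog_deriv ^^ n) f w = (rlog_deriv ^^ n) g w"
proof -
  have "eventually (\<lambda>x. (rlog_deriv ^^ n) f x = (rlog_deriv ^^ n) g x) (nhds w)"
  proof (induction n)
    case 0
    show ?case using assms by simp
  next
    case (Suc n)
    then have "eventually (\<lambda>y. eventually (\<lambda>x. (rlog_deriv ^^ n) f x = (rlog_deriv ^^ n) g x) (nhds y)) (nhds w)"
      by (simp add: eventually_eventually)
    then show ?case
      by eventually_elim (auto simp: rlog_deriv_def[of "(rlog_deriv ^^ n) _"] intro!: deriv_cong_ev)
  qed
  then show ?thesis by (rule eventually_nhds_x_imp_x)
qed

lemma higher_rlog_deriv_cong:
  assumes "open S" "w \<in> S" "\<And>x. x \<in> S \<Longrightarrow> f x = g x"
  shows "(rlog_deriv ^^ n) f w = (rlog_deriv ^^ n) g w"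
  using assms by (intro higher_rlog_deriv_cong_ev eventually_mono[OF eventually_nhds_in_open[of S]]) auto

lemma holomorphic_higher_rlog_deriv:
  assumes "f holomorphic_on S" "open S"
  shows "(rlog_deriv ^^ n) f holomorphic_on S"
proof (induction n)
  case (Suc n)
  have "(\<lambda>w. deriv ((rlog_deriv ^^ n) f) w / exp w) holomorphic_on S"
    by (intro holomorphic_intros Suc assms) auto
  then show ?case by (simp add: rlog_deriv_def[of "(rlog_deriv ^^ n) _", abs_def])
qed (use assms in simp)

lemma higher_rlog_deriv_diff:
  assumes "f holomorphic_on S" "g holomorphic_on S" "open S" "w \<in> S"
  shows "(rlog_deriv ^^ n) (\<lambda>w. f w - g w) w = (rlog_deriv ^^ n) f w - (rlog_deriv ^^ n) g w"
  using \<open>w \<in> S\<close>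
proof (induction n arbitrary: w)
  case (Suc n)
  have fd: "(rlog_deriv ^^ n) h field_differentiable at w" if "h holomorphic_on S" for h
    using holomorphic_higher_rlog_deriv[OF that assms(3)] assms(3) Suc.prems
    by (rule holomorphic_on_imp_differentiable_at)
  have "deriv ((rlog_deriv ^^ n) (\<lambda>w. f w - g w)) w = deriv (\<lambda>w. (rlog_deriv ^^ n) f w - (rlog_deriv ^^ n) g w) w"
    using Suc.prems assms(3) Suc.IH
    by (intro deriv_cong_ev eventually_mono[OF eventually_nhds_in_open[of S]]) auto
  also have "\<dots> = deriv ((rlog_deriv ^^ n) f) w - deriv ((rlog_deriv ^^ n) g) w"
    using fd assms by (intro deriv_diff) auto
  finally show ?case by (simp add: rlog_deriv_def[of "(rlog_deriv ^^ n) _"] diff_divide_distrib)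
qed simp

text \<open>The Taylor polynomial $\sum_{p<n} a_p z^p / p!$ in the logarithmic coordinate.\<close>
definition taylor_poly :: "(nat \<Rightarrow> complex) \<Rightarrow> nat \<Rightarrow> rlog \<Rightarrow> complex" where
  "taylor_poly a n w = (\<Sum>p<n. a p / fact p * exp (of_nat p * w))"

lemma holomorphic_taylor_poly: "taylor_poly a n holomorphic_on S"
  unfolding taylor_poly_def by (intro holomorphic_intros) auto

lemma rlog_deriv_taylor_poly:
  "rlog_deriv (taylor_poly a n) = taylor_poly (\<lambda>p. a (Suc p)) (n - 1)"
proof
  fix w
  have d: "((\<lambda>w. a p / fact p * exp (of_nat p * w)) has_field_derivative a p / fact p * (of_nat p * exp (of_nat p * w))) (at w)" for p
    by (auto intro!: derivative_eq_intros)
  have "(taylor_poly a n has_field_derivative (\<Sum>p<n. a p / fact p * (of_nat p * exp (of_nat p * w)))) (at w)"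
    unfolding taylor_poly_def[abs_def] by (intro DERIV_sum d)
  then have "deriv (taylor_poly a n) w = (\<Sum>p<n. a p / fact p * (of_nat p * exp (of_nat p * w)))"
    by (rule DERIV_imp_deriv)
  also have "\<dots> = exp w * taylor_poly (\<lambda>p. a (Suc p)) (n - 1) w"
  proof (cases n)
    case (Suc m)
    have "a (Suc p) / fact (Suc p) * (of_nat (Suc p) * exp (of_nat (Suc p) * w)) =
        exp w * (a (Suc p) / fact p * exp (of_nat p * w))" for p
    proof -
      have "exp (of_nat (Suc p) * w) = exp w * exp (of_nat p * w)"
        by (simp add: exp_add[symmetric] algebra_simps)
      then show ?thesis by (simp add: field_simps del: of_nat_Suc)
    qed
    then show ?thesis
      unfolding Suc sum.lessThan_Suc_shift taylor_poly_def sum_distrib_left by (simp del: of_nat_Suc fact_Suc)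
  qed (simp add: taylor_poly_def)
  finally show "rlog_deriv (taylor_poly a n) w = taylor_poly (\<lambda>p. a (Suc p)) (n - 1) w"
    by (simp add: rlog_deriv_def)
qed

lemma higher_rlog_deriv_taylor_poly:
  "(rlog_deriv ^^ k) (taylor_poly a n) = taylor_poly (\<lambda>p. a (p + k)) (n - k)"
  by (induction k) (simp_all add: rlog_deriv_taylor_poly)

text \<open>Cauchy's inequality on a smaller sector. A disc about \<open>z\<close> of radius \<open>2 c |z|\<close> lifts to the larger
  sector when \<open>c\<close> is small, and on the disc of radius \<open>c |z|\<close> a bound $A |z|^q$ deteriorates by at most
  $2^q$. The constant \<open>c\<close> depends only on the two openings.\<close>
lemma sector_Cauchy_estimate:
  assumes \<gamma>: "\<gamma> < r"
  shows "\<exists>c>0. \<forall>f A q n w. f holomorphic_on sector r \<longrightarrow>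
     (\<forall>w\<in>sector r. norm (f w) \<le> A * exp (real q * Re w)) \<longrightarrow> w \<in> sector \<gamma> \<longrightarrow>
     norm ((rlog_deriv ^^ n) f w) \<le> fact n * A * 2 ^ q / c ^ n * exp ((real q - real n) * Re w)"
proof -
  define c where "c = min (1/8) ((r - \<gamma>) * pi / 8)"
  have c: "c > 0" "c < 1/4" "4 * c \<le> (r - \<gamma>) * pi / 2" using \<gamma> by (auto simp: c_def)
  have "norm ((rlog_deriv ^^ n) f w) \<le> fact n * A * 2 ^ q / c ^ n * exp ((real q - real n) * Re w)"
    if f: "f holomorphic_on sector r" and bd: "\<And>w. w \<in> sector r \<Longrightarrow> norm (f w) \<le> A * exp (real q * Re w)"
      and w: "w \<in> sector \<gamma>" for f A q n w
  proof -
    \<comment> \<open>\<open>g\<close> is \<open>f\<close> written in the coordinate \<open>z\<close> near the point \<open>exp w\<close>, on the branch through \<open>w\<close>.\<close>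
    define g where "g z = f (w + Ln (z / exp w))" for z
    define U where "U = ball (exp w) (2 * c * exp (Re w))"
    have near: "Re (z / exp w) > 0" "w + Ln (z / exp w) \<in> sector r" "z \<noteq> 0" if "z \<in> U" for z
    proof -
      define u where "u = z / exp w - 1"
      have "norm u = norm (z - exp w) / exp (Re w)"
        by (simp add: u_def norm_divide[symmetric] diff_divide_distrib flip: norm_exp_eq_Re)
      also have "\<dots> < 2 * c"
        using that by (simp add: U_def dist_norm norm_minus_commute divide_less_eq)
      finally have u: "norm u < 2 * c" .
      have "norm (Ln (1 + u)) \<le> 2 * norm u"
        using u c by (intro norm_Ln_le) simp
      then have "\<bar>Im (Ln (1 + u))\<bar> < (r - \<gamma>) * pi / 2"
        using u c abs_Im_le_cmod[of "Ln (1 + u)"] by linarith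
      then show "w + Ln (z / exp w) \<in> sector r"
      proof -
        have "\<bar>Im w + Im (Ln (1 + u))\<bar> < \<gamma> * pi / 2 + (r - \<gamma>) * pi / 2"
          using w \<open>\<bar>Im (Ln (1 + u))\<bar> < _\<close> unfolding sector_def by auto
        also have "\<dots> = r * pi / 2" by (simp add: field_simps)
        finally show ?thesis by (simp add: sector_def u_def)
      qed
      have "\<bar>Re u\<bar> < 1" using u c abs_Re_le_cmod[of u] by linarith
      then show "Re (z / exp w) > 0" by (simp add: u_def)
      then show "z \<noteq> 0" by auto
    qed
    have g: "g holomorphic_on U"
    proof -
      have "(\<lambda>z. w + Ln (z / exp w)) holomorphic_on U"
        using near(1) by (intro holomorphic_intros) (fastforce simp: complex_nonpos_Reals_iff)+
      then have "(f \<circ> (\<lambda>z. w + Ln (z / exp w))) holomorphic_on U"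
        using near by (intro holomorphic_on_compose_gen[OF _ f]) auto
      then show ?thesis by (simp add: g_def[abs_def] o_def)
    qed
    have ev: "eventually (\<lambda>x. f x = g (exp x)) (nhds w)"
    proof -
      have "f x = g (exp x)" if "x \<in> ball w 1" for x
      proof -
        have "\<bar>Im (x - w)\<bar> < 1" using that abs_Im_le_cmod[of "x - w"]
          by (auto simp: dist_norm norm_minus_commute)
        then have "Ln (exp (x - w)) = x - w"
          using pi_gt3 by (intro Ln_exp) auto
        then show ?thesis by (simp add: g_def exp_diff[symmetric])
      qed
      then show ?thesis by (intro eventually_mono[OF eventually_nhds_in_open[of "ball w 1"]]) auto
    qed
    have inU: "exp w \<in> U" using c by (simp add: U_def)
    have "(rlog_deriv ^^ n) f w = (rlog_deriv ^^ n) (\<lambda>x. g (exp x)) w"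
      by (rule higher_rlog_deriv_cong_ev[OF ev])
    also have "\<dots> = (deriv ^^ n) g (exp w)"
      by (rule rlog_deriv_exp[OF g _ inU]) (simp add: U_def)
    also have "norm \<dots> \<le> fact n * (A * (2 * exp (Re w)) ^ q) / (c * exp (Re w)) ^ n"
    proof (rule Cauchy_inequality)
      have sub: "cball (exp w) (c * exp (Re w)) \<subseteq> U"
      proof -
        have "c * exp (Re w) < 2 * c * exp (Re w)" using c by simp
        then show ?thesis unfolding U_def by (auto intro: order_le_less_trans)
      qed
      then show "continuous_on (cball (exp w) (c * exp (Re w))) g"
        using g holomorphic_on_imp_continuous_on continuous_on_subset by blast
      show "g holomorphic_on ball (exp w) (c * exp (Re w))"
        using g sub ball_subset_cball holomorphic_on_subset by blast
      show "0 < c * exp (Re w)" using c by simp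
      fix z assume z: "norm (exp w - z) = c * exp (Re w)"
      then have zU: "z \<in> U" using sub by (auto simp: dist_norm)
      note nz = near[OF zU]
      have A0: "A \<ge> 0"
        using bd[OF nz(2)] by (smt (verit) exp_gt_zero mult_neg_pos norm_ge_zero)
      have "norm z \<le> norm (exp w) + norm (exp w - z)"
        by norm
      also have "\<dots> \<le> 2 * exp (Re w)" using z c by (simp add: mult_right_mono)
      finally have nz2: "norm z \<le> 2 * exp (Re w)" .
      have zw: "z / exp w \<noteq> 0" using nz by auto
      have "exp (Re (w + Ln (z / exp w))) = norm (exp (w + Ln (z / exp w)))"
        by (simp only: norm_exp_eq_Re)
      also have "exp (w + Ln (z / exp w)) = z" using zw by (simp add: exp_add)
      finally have ez: "exp (Re (w + Ln (z / exp w))) = norm z" .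
      have "norm (g z) \<le> A * exp (Re (w + Ln (z / exp w))) ^ q"
        using bd[OF nz(2)] by (simp add: g_def exp_of_nat_mult[symmetric])
      also have "\<dots> \<le> A * (2 * exp (Re w)) ^ q"
        unfolding ez using A0 nz2 by (intro mult_left_mono power_mono) auto
      finally show "norm (g z) \<le> A * (2 * exp (Re w)) ^ q" .
    qed
    also have "\<dots> = fact n * A * 2 ^ q / c ^ n * exp ((real q - real n) * Re w)"
      using c by (simp add: power_mult_distrib exp_of_nat_mult left_diff_distrib exp_diff)
    finally show ?thesis .
  qed
  then show ?thesis using c(1) by blast
qed

section \<open>The extension operator\<close>

lemma Lambda_norm_ge:
  assumes "a \<in> Lambda_space M h" "h > 0" "\<And>p. M p > 0"
  shows "norm (a p) \<le> Lambda_norm M h a * (h ^ p * M p)"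
proof -
  have "norm (a p) / (h ^ p * M p) \<le> Lambda_norm M h a"
    unfolding Lambda_norm_def using assms(1) by (intro cSUP_upper) (auto simp: Lambda_space_def)
  then show ?thesis using assms by (simp add: pos_divide_le_eq)
qed

lemma Lambda_norm_nonneg:
  assumes "a \<in> Lambda_space M h" "h > 0" "\<And>p. M p > 0"
  shows "Lambda_norm M h a \<ge> 0"
proof -
  have "0 \<le> Lambda_norm M h a * (h ^ 0 * M 0)"
    using Lambda_norm_ge[OF assms, of 0] norm_ge_zero order_trans by blast
  then show ?thesis using assms(3)[of 0] by (simp add: zero_le_mult_iff)
qed

lemma Lambda_spaceI:
  assumes "\<And>p. norm (a p) \<le> A * (h ^ p * M p)" "h > 0" "\<And>p. M p > 0"
  shows "a \<in> Lambda_space M h"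
  unfolding Lambda_space_def using assms
  by (auto intro!: bdd_aboveI[of _ A] simp: pos_divide_le_eq)

lemma Lambda_space_lincomb:
  assumes "a \<in> Lambda_space M h" "b \<in> Lambda_space M h" "h > 0" "\<And>p. M p > 0"
  shows "(\<lambda>p. c * a p + d * b p) \<in> Lambda_space M h"
proof (rule Lambda_spaceI[OF _ assms(3,4)])
  fix p
  have "norm (c * a p + d * b p) \<le> norm c * norm (a p) + norm d * norm (b p)"
    by (metis norm_mult norm_triangle_ineq)
  also have "\<dots> \<le> norm c * (Lambda_norm M h a * (h ^ p * M p)) + norm d * (Lambda_norm M h b * (h ^ p * M p))"
    using assms by (intro add_mono mult_left_mono Lambda_norm_ge) auto
  finally show "norm (c * a p + d * b p) \<le>
     (norm c * Lambda_norm M h a + norm d * Lambda_norm M h b) * (h ^ p * M p)"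
    by (simp add: algebra_simps)
qed

text \<open>The extension operator obtained from cut-offs. With $R = 1 / (2 B h)$ it is
  $f_a(z) = \sum_p \frac{a_p}{p!}\, z^p\, \frac{\Phi_p(R/z)}{m_p}$, in which $\Phi_p(R/z)/m_p$ is close to \<open>1\<close> for
  small \<open>z\<close>. The coefficients $a_p / (p!\, m_p)$ are $O((h B)^p)$. In the \<open>n\<close>-th Taylor remainder of $f_a$ the term
  of index \<open>p\<close> carries $m_p - \Phi_p$ if $p < n$ and $\Phi_p$ if $p \ge n$; either way it is at most a
  constant times $2^{-p} N_n (2 B h)^n |z|^n$. Cauchy's inequality turns these remainder estimates into the bounds
  and the boundary values of the derivatives.\<close>
lemma extension_operator:
  fixes L N :: "nat \<Rightarrow> real" and \<Phi> :: "nat \<Rightarrow> complex \<Rightarrow> complex" and m :: "nat \<Rightarrow> complex"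
  assumes \<gamma>: "0 < \<gamma>" "\<gamma> < r"
    and L: "\<And>p. L p > 0" and N: "\<And>n. N n > 0" and C: "C > 0" and B: "B > 0" and C0: "C0 > 0"
    and hol: "\<And>p. \<Phi> p holomorphic_on sector r"
    and small: "\<And>n p s. n \<le> p \<Longrightarrow> s \<in> sector r \<Longrightarrow>
                   norm (\<Phi> p s) \<le> C * N n * exp ((real p - real n) * Re s)"
    and large: "\<And>n p s. p < n \<Longrightarrow> s \<in> sector r \<Longrightarrow>
                   norm (m p - \<Phi> p s) \<le> C * N n * exp ((real p - real n) * Re s)"
    and mass: "\<And>p. L p \<le> C0 * B ^ p * norm (m p)"
  shows "\<exists>k1>0. \<forall>h>0. \<exists>E.
     linear_continuous (hat L) h (hat N) (k1 * h) (sector \<gamma>) E \<and>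
     (\<forall>a\<in>Lambda_space (hat L) h. has_borel_image \<gamma> (E a) a)"
proof -
  obtain c where c: "c > 0" and Cauchy_est: "\<And>f A q n w. f holomorphic_on sector r \<Longrightarrow>
     (\<And>w. w \<in> sector r \<Longrightarrow> norm (f w) \<le> A * exp (real q * Re w)) \<Longrightarrow> w \<in> sector \<gamma> \<Longrightarrow>
     norm ((rlog_deriv ^^ n) f w) \<le> fact n * A * 2 ^ q / c ^ n * exp ((real q - real n) * Re w)"
    using sector_Cauchy_estimate[OF \<gamma>(2)] by metis
  have sub: "sector \<gamma> \<subseteq> sector r"
    using \<gamma> by (auto simp: sector_def intro: less_le_trans)
  have hatL: "hat L p > 0" and hatN: "hat N p > 0" for p
    using L N by (simp_all add: hat_def)
  define k1 where "k1 = 4 * B / c"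
  have k1: "k1 > 0" using B c by (simp add: k1_def)
  have "\<exists>E. linear_continuous (hat L) h (hat N) (k1 * h) (sector \<gamma>) E \<and>
     (\<forall>a\<in>Lambda_space (hat L) h. has_borel_image \<gamma> (E a) a)" if h: "h > 0" for h
  proof -
    \<comment> \<open>The factor \<open>2\<close> makes the coefficient bound \<open>(h * B) ^ p\<close> times \<open>exp \<rho> ^ p\<close> equal to \<open>2\<close> to the power \<open>- p\<close>.\<close>
    define \<rho> where "\<rho> = ln (1 / (2 * B * h))"
    have exp_\<rho>: "exp \<rho> = 1 / (2 * B * h)" using B h by (simp add: \<rho>_def)
    define t where "t a p w = a p / (fact p * m p) * exp (of_nat p * w) * \<Phi> p (of_real \<rho> - w)"
      for a :: "nat \<Rightarrow> complex" and p w
    define E where "E a w = (\<Sum>p. t a p w)" for a w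
    have m0: "m p \<noteq> 0" for p using mass[of p] L[of p] by auto
    have reflect: "of_real \<rho> - w \<in> sector r" if "w \<in> sector r" for w
      using that by (simp add: sector_def)
    let ?\<Lambda> = "Lambda_space (hat L) h"
    define K where "K a = C0 * C * Lambda_norm (hat L) h a" for a
    have K0: "K a \<ge> 0" if "a \<in> ?\<Lambda>" for a
      using Lambda_norm_nonneg[OF that h hatL] C C0 by (simp add: K_def)
    \<comment> \<open>The terms of the \<open>n\<close>-th Taylor remainder.\<close>
    have bound: "norm (t a p w - (if p < n then a p / fact p * exp (of_nat p * w) else 0))
        \<le> K a * N n * (2 * B * h) ^ n * exp (real n * Re w) * (1/2) ^ p"
      if a: "a \<in> ?\<Lambda>" and w: "w \<in> sector r" for a p w n
    proof -
      let ?A = "Lambda_norm (hat L) h a"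
      have A: "?A \<ge> 0" by (rule Lambda_norm_nonneg[OF a h hatL])
      have "norm (a p) \<le> ?A * (h ^ p * (fact p * L p))"
        using Lambda_norm_ge[OF a h hatL, of p] by (simp add: hat_def[of L p])
      also have "\<dots> \<le> ?A * (h ^ p * (fact p * (C0 * B ^ p * norm (m p))))"
        using A h by (intro mult_left_mono mass) auto
      finally have coeff: "norm (a p / (fact p * m p)) \<le> ?A * C0 * (h * B) ^ p"
        using m0[of p] by (simp add: norm_divide norm_mult divide_le_eq power_mult_distrib mult_ac)
      let ?s = "of_real \<rho> - w"
      have cut: "norm (\<Phi> p ?s - (if p < n then m p else 0)) \<le> C * N n * exp ((real p - real n) * (\<rho> - Re w))"
        using small[of n p ?s] large[of p n ?s] reflect[OF w] by (auto simp: norm_minus_commute)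
      have "t a p w - (if p < n then a p / fact p * exp (of_nat p * w) else 0)
          = a p / (fact p * m p) * exp (of_nat p * w) * (\<Phi> p ?s - (if p < n then m p else 0))"
        using m0[of p] by (simp add: t_def field_simps)
      then have "norm (t a p w - (if p < n then a p / fact p * exp (of_nat p * w) else 0))
          = norm (a p / (fact p * m p)) * exp (real p * Re w) * norm (\<Phi> p ?s - (if p < n then m p else 0))"
        by (simp only: norm_mult norm_exp_eq_Re) simp
      also have "\<dots> \<le> (?A * C0 * (h * B) ^ p) * exp (real p * Re w)
           * (C * N n * exp ((real p - real n) * (\<rho> - Re w)))"
        using coeff cut A C0 h B by (intro mult_mono) auto
      also have "\<dots> = K a * N n * (h * B) ^ p * (exp (real p * Re w) * exp ((real p - real n) * (\<rho> - Re w)))"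
        by (simp add: K_def mult_ac)
      also have "exp (real p * Re w) * exp ((real p - real n) * (\<rho> - Re w))
          = exp (real n * Re w) * (exp \<rho> ^ p / exp \<rho> ^ n)"
        by (simp add: exp_of_nat_mult[symmetric] exp_add[symmetric] exp_diff[symmetric] algebra_simps)
      also have "exp \<rho> ^ p / exp \<rho> ^ n = (2 * B * h) ^ n / (2 * B * h) ^ p"
        using B h by (simp add: exp_\<rho> power_divide)
      also have "K a * N n * (h * B) ^ p * (exp (real n * Re w) * ((2 * B * h) ^ n / (2 * B * h) ^ p))
          = K a * N n * (2 * B * h) ^ n * exp (real n * Re w) * (1/2) ^ p"
        using B h by (simp add: power_mult_distrib power_divide field_simps)
      finally show ?thesis .
    qed
    have bound0: "norm (t a p w) \<le> K a * N 0 * (1/2) ^ p" if "a \<in> ?\<Lambda>" "w \<in> sector r" for a p w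
      using bound[OF that, of p 0] by simp
    have sm_half: "summable (\<lambda>p. Q * (1/2 :: real) ^ p)" for Q
      by (intro summable_mult summable_geometric) simp
    have sm: "summable (\<lambda>p. t a p w)" if "a \<in> ?\<Lambda>" "w \<in> sector r" for a w
      by (rule summable_comparison_test'[OF sm_half]) (rule bound0[OF that])
    have rem: "norm (E a w - taylor_poly a n w) \<le> (2 * K a * N n * (2 * B * h) ^ n) * exp (real n * Re w)"
      if a: "a \<in> ?\<Lambda>" and w: "w \<in> sector r" for a w n
    proof -
      let ?u = "\<lambda>p. if p < n then a p / fact p * exp (of_nat p * w) else 0"
      have "?u sums taylor_poly a n w"
        unfolding taylor_poly_def lessThan_def by (rule sums_If_finite) simp
      then have "(\<lambda>p. t a p w - ?u p) sums (E a w - taylor_poly a n w)"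
        unfolding E_def by (intro sums_diff summable_sums sm[OF a w])
      then have eq: "E a w - taylor_poly a n w = (\<Sum>p. t a p w - ?u p)"
        by (rule sums_unique)
      have "norm (\<Sum>p. t a p w - ?u p) \<le> (\<Sum>p. K a * N n * (2 * B * h) ^ n * exp (real n * Re w) * (1/2) ^ p)"
        by (rule norm_suminf_le[OF bound[OF a w] sm_half])
      also have "\<dots> = K a * N n * (2 * B * h) ^ n * exp (real n * Re w) * 2"
        by (subst suminf_mult) (auto simp: suminf_geometric)
      finally show ?thesis by (simp add: eq)
    qed
    have holE: "E a holomorphic_on sector r" if a: "a \<in> ?\<Lambda>" for a
    proof (rule holomorphic_uniform_sequence[where f = "\<lambda>n w. \<Sum>p<n. t a p w"])
      show "open (sector r)" by (rule open_sector)
      have "(\<lambda>w. \<Phi> p (of_real \<rho> - w)) holomorphic_on sector r" for p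
      proof -
        have "(\<Phi> p \<circ> (\<lambda>w. of_real \<rho> - w)) holomorphic_on sector r"
          using reflect by (intro holomorphic_on_compose_gen[OF _ hol]) (auto intro!: holomorphic_intros)
        then show ?thesis by (simp add: o_def)
      qed
      then show "(\<lambda>w. \<Sum>p<n. t a p w) holomorphic_on sector r" for n
        unfolding t_def using m0 by (intro holomorphic_intros) auto
      fix x assume "x \<in> sector r"
      then obtain d where d: "d > 0" "cball x d \<subseteq> sector r"
        using open_contains_cball open_sector by blast
      have "uniform_limit (cball x d) (\<lambda>n w. \<Sum>p<n. t a p w) (\<lambda>w. \<Sum>p. t a p w) sequentially"
        by (rule Weierstrass_m_test[OF _ sm_half]) (use bound0[OF a] d in blast)
      then show "\<exists>d>0. cball x d \<subseteq> sector r \<and> uniform_limit (cball x d) (\<lambda>n w. \<Sum>p<n. t a p w) (E a) sequentially"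
        using d by (auto simp: E_def[abs_def])
    qed
    have holrem: "(\<lambda>w. E a w - taylor_poly a n w) holomorphic_on sector r" if "a \<in> ?\<Lambda>" for a n
      by (intro holomorphic_intros holE that holomorphic_taylor_poly)
    \<comment> \<open>Order \<open>q = n\<close> gives the bounds of the derivatives, order \<open>q = n + 1\<close> their limits.\<close>
    have derrem: "norm ((rlog_deriv ^^ n) (E a) w - taylor_poly (\<lambda>p. a (p + n)) (q - n) w) \<le>
        fact n * (2 * K a * N q * (2 * B * h) ^ q) * 2 ^ q / c ^ n * exp ((real q - real n) * Re w)"
      if a: "a \<in> ?\<Lambda>" and w: "w \<in> sector \<gamma>" for a w n q
      using Cauchy_est[OF holrem[OF a, of q] rem[OF a, where n = q] w, of n] w sub
        higher_rlog_deriv_diff[OF holE[OF a] holomorphic_taylor_poly open_sector, of w n a q]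
      by (auto simp: higher_rlog_deriv_taylor_poly)
    have ultra: "norm ((rlog_deriv ^^ n) (E a) w) / ((k1 * h) ^ n * hat N n) \<le> 2 * K a"
      if a: "a \<in> ?\<Lambda>" and w: "w \<in> sector \<gamma>" for a w n
    proof -
      have "norm ((rlog_deriv ^^ n) (E a) w) \<le> fact n * (2 * K a * N n * (2 * B * h) ^ n) * 2 ^ n / c ^ n"
        using derrem[OF a w, of n n] by (simp add: taylor_poly_def)
      also have "\<dots> = 2 * K a * (((2 * B * h) ^ n * 2 ^ n) / c ^ n * hat N n)"
        by (simp add: hat_def mult_ac)
      also have "((2 * B * h) ^ n * 2 ^ n) / c ^ n = (k1 * h) ^ n"
        by (simp only: power_mult_distrib[symmetric] power_divide[symmetric]) (simp add: k1_def mult_ac)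
      finally show ?thesis
        using k1 h hatN[of n] by (subst pos_divide_le_eq) auto
    qed
    have add: "E (\<lambda>p. a p + b p) w = E a w + E b w" if "a \<in> ?\<Lambda>" "b \<in> ?\<Lambda>" "w \<in> sector r" for a b w
      unfolding E_def suminf_add[OF sm[OF that(1,3)] sm[OF that(2,3)]]
      by (simp add: t_def add_divide_distrib ring_distribs)
    have scale: "E (\<lambda>p. d * a p) w = d * E a w" if "a \<in> ?\<Lambda>" "w \<in> sector r" for a d w
      unfolding E_def suminf_mult[OF sm[OF that], symmetric] by (simp add: t_def mult_ac)
    have diff_mem: "(\<lambda>p. b p - a p) \<in> ?\<Lambda>" if "a \<in> ?\<Lambda>" "b \<in> ?\<Lambda>" for a b
      using Lambda_space_lincomb[OF that(2,1) h hatL, of 1 "-1"] by simp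
    have diff: "E b w - E a w = E (\<lambda>p. b p - a p) w" if "a \<in> ?\<Lambda>" "b \<in> ?\<Lambda>" "w \<in> sector r" for a b w
      using add[OF diff_mem[OF that(1,2)] that(1,3)] by simp
    have "linear_continuous (hat L) h (hat N) (k1 * h) (sector \<gamma>) E"
      unfolding linear_continuous_def
    proof (intro conjI ballI allI impI)
      fix a assume a: "a \<in> ?\<Lambda>"
      show "E a \<in> ultra_space (hat N) (k1 * h) (sector \<gamma>)"
        unfolding ultra_space_def using holomorphic_on_subset[OF holE[OF a] sub] ultra[OF a]
        by (auto intro!: bdd_aboveI[of _ "2 * K a"])
      fix \<epsilon> :: real assume \<epsilon>: "\<epsilon> > 0"
      define \<delta> where "\<delta> = \<epsilon> / (2 * C0 * C)"
      have "ultra_norm (hat N) (k1 * h) (sector \<gamma>) (\<lambda>w. E b w - E a w) < \<epsilon>"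
        if b: "b \<in> ?\<Lambda>" and lt: "Lambda_norm (hat L) h (\<lambda>p. b p - a p) < \<delta>" for b
      proof -
        have ba: "(\<lambda>p. b p - a p) \<in> ?\<Lambda>" by (rule diff_mem[OF a b])
        have eq: "(rlog_deriv ^^ n) (\<lambda>w. E b w - E a w) w = (rlog_deriv ^^ n) (E (\<lambda>p. b p - a p)) w"
          if "w \<in> sector \<gamma>" for n w
          using diff[OF a b] sub that by (intro higher_rlog_deriv_cong[OF open_sector[of \<gamma>]]) auto
        have "of_real 0 \<in> sector \<gamma>" using \<gamma> by (simp add: sector_def)
        then have "ultra_norm (hat N) (k1 * h) (sector \<gamma>) (\<lambda>w. E b w - E a w) \<le> 2 * K (\<lambda>p. b p - a p)"
          unfolding ultra_norm_def using ultra[OF ba] eq by (intro cSUP_least) auto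
        also have "\<dots> < \<epsilon>"
          using lt C C0 by (simp add: K_def \<delta>_def field_simps)
        finally show ?thesis .
      qed
      moreover have "\<delta> > 0" using \<epsilon> C C0 by (simp add: \<delta>_def)
      ultimately show "\<exists>\<delta>>0. \<forall>b\<in>?\<Lambda>. Lambda_norm (hat L) h (\<lambda>p. b p - a p) < \<delta> \<longrightarrow>
          ultra_norm (hat N) (k1 * h) (sector \<gamma>) (\<lambda>w. E b w - E a w) < \<epsilon>" by blast
    qed (use add scale sub in auto)
    moreover have "has_borel_image \<gamma> (E a) a" if a: "a \<in> ?\<Lambda>" for a
      unfolding has_borel_image_def
    proof
      fix n
      define Q where "Q = fact n * (2 * K a * N (Suc n) * (2 * B * h) ^ Suc n) * 2 ^ Suc n / c ^ n"
      have le: "norm ((rlog_deriv ^^ n) (E a) w - a n) \<le> Q * norm (exp w)" if "w \<in> sector \<gamma>" for w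
        using derrem[OF a that, of n "Suc n"] by (simp add: taylor_poly_def Q_def)
      have "((\<lambda>w. (rlog_deriv ^^ n) (E a) w - a n) \<longlongrightarrow> 0) (sector_at_0 \<gamma>)"
      proof (rule Lim_null_comparison)
        show "eventually (\<lambda>w. norm ((rlog_deriv ^^ n) (E a) w - a n) \<le> Q * norm (exp w)) (sector_at_0 \<gamma>)"
          unfolding sector_at_0_def using le by (auto simp: eventually_inf_principal)
        have "filterlim exp (nhds 0) (sector_at_0 \<gamma>)"
          unfolding sector_at_0_def by (rule filterlim_mono[OF filterlim_filtercomap]) auto
        then have "((\<lambda>w. Q * norm (exp w)) \<longlongrightarrow> Q * norm (0::complex)) (sector_at_0 \<gamma>)"
          by (intro tendsto_intros)
        then show "((\<lambda>w. Q * norm (exp w)) \<longlongrightarrow> 0) (sector_at_0 \<gamma>)" by simp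
      qed
      then show "((rlog_deriv ^^ n) (E a) \<longlongrightarrow> a n) (sector_at_0 \<gamma>)"
        by (simp add: LIM_zero_iff)
    qed
    ultimately show ?thesis by blast
  qed
  then show ?thesis using k1 by blast
qed

section \<open>Weight sequences given by their quotients\<close>

lemma LC_quot:
  assumes "N \<in> LC"
  shows "quot N k > 0" and "quot N (Suc 0) \<ge> 1"
    and "quot N (Suc j) \<le> quot N (Suc (Suc j))"
    and "N n = (\<Prod>j<n. quot N (Suc j))"
proof -
  have pos: "N k > 0" and N0: "N 0 = 1" and N1: "1 \<le> N 1"
    and lc: "j \<ge> 1 \<Longrightarrow> (N j)\<^sup>2 \<le> N (j - 1) * N (j + 1)" for j k
    using assms by (auto simp: LC_def)
  show "quot N k > 0" using pos by (simp add: quot_def)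
  show "quot N (Suc 0) \<ge> 1" using N0 N1 by (simp add: quot_def)
  show "quot N (Suc j) \<le> quot N (Suc (Suc j))"
    using lc[of "Suc j"] pos[of j] pos[of "Suc j"]
    by (simp add: quot_def field_simps power2_eq_square)
  show "N n = (\<Prod>j<n. quot N (Suc j))"
  proof (induction n)
    case (Suc n)
    have "N (Suc n) = N n * quot N (Suc n)"
      using pos[of n] by (simp add: quot_def)
    also have "\<dots> = (\<Prod>j<Suc n. quot N (Suc j))" by (subst Suc) simp
    finally show ?case .
  qed (simp add: N0)
qed

lemma quot_prod:
  assumes "\<And>j. q (Suc j) > (0::real)"
  shows "quot (\<lambda>n. \<Prod>j<n. q (Suc j)) (Suc k) = q (Suc k)"
proof -
  have "q (Suc j) \<noteq> 0" for j using assms[of j] by simp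
  then show ?thesis by (simp add: quot_def)
qed

text \<open>The lower bound for the quotients gives $(M_n)^{1/n} \ge (n!)^{r/n} \ge (n/e)^r$ for the sequence
  \<open>M\<close> with these quotients.\<close>
lemma prod_in_LC:
  fixes q :: "nat \<Rightarrow> real"
  assumes r: "r > 0" and mono: "\<And>j. q (Suc j) \<le> q (Suc (Suc j))"
    and ge: "\<And>j. q (Suc j) \<ge> real (Suc j) powr r"
  shows "(\<lambda>n. \<Prod>j<n. q (Suc j)) \<in> LC"
proof -
  have q: "q (Suc j) > 0" for j
    by (rule less_le_trans[OF _ ge]) simp
  have pos: "(\<Prod>j<n. q (Suc j)) > 0" for n using q by (intro prod_pos) auto
  have lc: "(\<Prod>i<j. q (Suc i))\<^sup>2 \<le> (\<Prod>i<j - 1. q (Suc i)) * (\<Prod>i<j + 1. q (Suc i))" if "j \<ge> 1" for j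
  proof -
    obtain k where k: "j = Suc k" using \<open>j \<ge> 1\<close> by (cases j) auto
    have "(\<Prod>i<k. q (Suc i))\<^sup>2 * q (Suc k) * q (Suc k) \<le> (\<Prod>i<k. q (Suc i))\<^sup>2 * q (Suc k) * q (Suc (Suc k))"
      using mono q[of k] by (intro mult_left_mono) auto
    then show ?thesis by (simp add: k power2_eq_square mult_ac)
  qed
  have root: "(real n / exp 1) powr r \<le> (\<Prod>j<n. q (Suc j)) powr (1 / real n)" if n: "n > 0" for n
  proof -
    have "real n ^ n / fact n \<le> exp (real n)"
    proof -
      have "(\<Sum>k\<in>{n}. real n ^ k /\<^sub>R fact k) \<le> (\<Sum>k. real n ^ k /\<^sub>R fact k)"
        by (rule sum_le_suminf[OF summable_exp_generic]) auto
      then show ?thesis by (simp add: exp_def divide_inverse mult.commute)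
    qed
    then have "(real n / exp 1) ^ n \<le> fact n"
      by (simp add: power_divide divide_le_eq mult.commute exp_of_nat_mult[symmetric])
    then have "((real n / exp 1) ^ n) powr r \<le> fact n powr r"
      using r by (intro powr_mono2) auto
    also have "fact n powr r = (\<Prod>j<n. real (Suc j) powr r)"
      by (induction n) (simp_all add: powr_mult mult.commute del: of_nat_Suc)
    also have "\<dots> \<le> (\<Prod>j<n. q (Suc j))"
      by (intro prod_mono conjI ge) auto
    finally have "(((real n / exp 1) ^ n) powr r) powr (1 / real n) \<le> (\<Prod>j<n. q (Suc j)) powr (1 / real n)"
      by (intro powr_mono2) auto
    also have "(((real n / exp 1) ^ n) powr r) powr (1 / real n) = (real n / exp 1) powr r"
      using n by (simp add: powr_powr powr_realpow[symmetric] mult_ac)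
    finally show ?thesis .
  qed
  have "filterlim (\<lambda>n. (real n / exp 1) powr r) at_top sequentially"
    using r by real_asymp
  then have lim: "filterlim (\<lambda>n. (\<Prod>j<n. q (Suc j)) powr (1 / real n)) at_top sequentially"
    by (rule filterlim_at_top_mono) (use root in \<open>auto intro: eventually_mono[OF eventually_gt_at_top[of 0]]\<close>)
  have "1 \<le> q (Suc 0)" using ge[of 0] by simp
  then show ?thesis using pos lc lim by (simp add: LC_def)
qed

text \<open>Doubling of the quotients implies moderate growth. By log-convexity the product $M_j M_k$ does not
  increase when the indices move towards each other with constant sum, so only indices that differ by at most
  one have to be examined, and for them the quotients of index $2i - 1$ and $2i$ are compared with
  the one of index \<open>i\<close>.\<close>
lemma prod_mg:
  fixes q :: "nat \<Rightarrow> real"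
  assumes q: "\<And>j. q (Suc j) > 0" and mono: "\<And>j. q (Suc j) \<le> q (Suc (Suc j))"
    and A: "A \<ge> 1" and dbl: "\<And>k. k \<ge> 1 \<Longrightarrow> q (2 * k) \<le> A * q k"
  shows "(\<Prod>i<j + k. q (Suc i)) \<le> A ^ (j + k) * (\<Prod>i<j. q (Suc i)) * (\<Prod>i<k. q (Suc i))"
proof -
  define P where "P n = (\<Prod>i<n. q (Suc i))" for n
  have P: "P n > 0" for n unfolding P_def using q by (intro prod_pos) auto
  have PS: "P (Suc n) = P n * q (Suc n)" for n by (simp add: P_def)
  have mono': "q (Suc i) \<le> q (Suc j)" if "i \<le> j" for i j
    by (rule lift_Suc_mono_le[of "\<lambda>i. q (Suc i)", OF mono that])
  have dbl': "q (Suc (Suc (2 * n))) \<le> A * q (Suc n)" for n using dbl[of "Suc n"] by simp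
  have even: "P (2 * n) \<le> A ^ (2 * n) * (P n)\<^sup>2" for n
  proof (induction n)
    case (Suc n)
    have "q (Suc (2 * n)) * q (Suc (Suc (2 * n))) \<le> (A * q (Suc n)) * (A * q (Suc n))"
      using order_trans[OF mono dbl'] dbl' q A by (intro mult_mono) (auto simp: less_imp_le)
    then have "P (2 * n) * (q (Suc (2 * n)) * q (Suc (Suc (2 * n)))) \<le>
        (A ^ (2 * n) * (P n)\<^sup>2) * ((A * q (Suc n)) * (A * q (Suc n)))"
      using Suc P q A by (intro mult_mono[of "P (2 * n)"]) (auto simp: less_imp_le)
    then show ?case by (simp add: PS power2_eq_square mult_ac)
  qed (simp add: P_def)
  have odd: "P (Suc (2 * n)) \<le> A ^ (Suc (2 * n)) * P n * P (Suc n)" for n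
  proof -
    have "P (2 * n) * q (Suc (2 * n)) \<le> (A ^ (2 * n) * (P n)\<^sup>2) * (A * q (Suc n))"
      using even[of n] order_trans[OF mono dbl'] q A P by (intro mult_mono) (auto simp: less_imp_le)
    then show ?thesis by (simp add: PS power2_eq_square mult_ac)
  qed
  have le: "P (j + k) \<le> A ^ (j + k) * P j * P k" if "j \<le> k" for j k
    using that
  proof (induction "k - j" arbitrary: j k rule: less_induct)
    case less
    consider "k = j" | "k = Suc j" | "j + 2 \<le> k" using less.prems by linarith
    then show ?case
    proof cases
      case 1
      then show ?thesis using even[of j] by (simp add: power2_eq_square mult.assoc flip: mult_2)
    next
      case 2
      then show ?thesis using odd[of j] by (simp add: mult_2)
    next
      case 3
      then obtain k' where k': "k = Suc k'" "Suc j \<le> k'" by (cases k) auto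
      have "P (Suc j + k') \<le> A ^ (Suc j + k') * P (Suc j) * P k'"
        using k' by (intro less.hyps) auto
      also have "\<dots> = A ^ (Suc j + k') * P j * P k' * q (Suc j)" by (simp add: PS mult_ac)
      also have "\<dots> \<le> A ^ (Suc j + k') * P j * P k' * q (Suc k')"
        using k' A P less_imp_le by (intro mult_left_mono mono') (auto simp: less_imp_le)
      finally show ?thesis by (simp add: k' PS mult_ac)
    qed
  qed
  show ?thesis
    using le[of j k] le[of k j] by (cases "j \<le> k") (auto simp: P_def add.commute mult_ac)
qed

text \<open>The sum of $k/m_k$ and $\sum_{j \ge k} 1/m_j$. For $m_k = \nu_k^{1/r}$ the quotients $\mu_k$ of a sequence that
  is dominated by \<open>N\<close> and satisfies $(M,N)_{\gamma_r}$ are limited by $\mu_k^{1/r} = O(k/\tau_k)$ with each of the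
  two summands in place of $\tau_k$. The sum is preferred to the maximum because it is monotone.\<close>
definition weighted_tail :: "(nat \<Rightarrow> real) \<Rightarrow> nat \<Rightarrow> real" where
  "weighted_tail m k = real k / m k + (\<Sum>j. 1 / m (j + k))"

lemma weighted_tail_ge:
  assumes "\<And>k. m k > 0" "summable (\<lambda>j. 1 / m j)"
  shows "weighted_tail m k > 0" "weighted_tail m k \<ge> real k / m k" "weighted_tail m k \<ge> (\<Sum>j. 1 / m (j + k))"
proof -
  have "summable (\<lambda>j. 1 / m (j + k))" using assms(2) by (rule summable_ignore_initial_segment)
  then have "(\<Sum>j. 1 / m (j + k)) > 0" using assms(1) by (intro suminf_pos) auto
  moreover have "real k / m k \<ge> 0" using assms(1)[of k] by simp
  ultimately show "weighted_tail m k > 0" "weighted_tail m k \<ge> real k / m k" "weighted_tail m k \<ge> (\<Sum>j. 1 / m (j + k))"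
    by (simp_all add: weighted_tail_def)
qed

lemma suminf_inverse_split:
  assumes "summable (\<lambda>j. 1 / m j)"
  shows "(\<Sum>j. 1 / m (j + k)) = 1 / (m k :: real) + (\<Sum>j. 1 / m (j + Suc k))"
  using suminf_split_head[OF summable_ignore_initial_segment[OF assms, of k]] by simp

text \<open>The difference of consecutive terms is $(k + 1)(1/m_k - 1/m_{k+1})$.\<close>
lemma weighted_tail_Suc_le:
  assumes "\<And>k. m k > 0" "summable (\<lambda>j. 1 / m j)" "m k \<le> m (Suc k)"
  shows "weighted_tail m (Suc k) \<le> weighted_tail m k"
proof -
  have "real (Suc k) / m (Suc k) \<le> real (Suc k) / m k"
    using assms(1,3) by (intro divide_left_mono) auto
  then show ?thesis
    by (simp add: weighted_tail_def suminf_inverse_split[OF assms(2), of k] add_divide_distrib)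
qed

text \<open>The growth hypothesis, multiplied by $2k/m_{2k}$, bounds $2k/m_k$. This
  covers the first summand and the terms of the series with index in $[k, 2k)$, each of which is at most
  $1/m_k$.\<close>
lemma weighted_tail_le_double:
  assumes pos: "\<And>k. m k > 0" and sm: "summable (\<lambda>j. 1 / m j)" and mono: "\<And>j. k \<le> j \<Longrightarrow> m k \<le> m j"
    and k: "k \<ge> 1" and C: "m (2 * k) / m k \<le> C + C * (m (2 * k) / real (2 * k)) * (\<Sum>j. 1 / m (j + 2 * k))"
  shows "weighted_tail m k \<le> (C + 1) * weighted_tail m (2 * k)"
proof -
  let ?S = "\<Sum>j. 1 / m (j + 2 * k)"
  have "(\<Sum>j. 1 / m (j + k)) = (\<Sum>j. 1 / m (j + k + k)) + (\<Sum>j<k. 1 / m (j + k))"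
    by (rule suminf_split_initial_segment[OF summable_ignore_initial_segment[OF sm]])
  also have "(\<Sum>j. 1 / m (j + k + k)) = ?S" by (simp add: mult_2 add.assoc)
  also have "(\<Sum>j<k. 1 / m (j + k)) \<le> (\<Sum>j<k. 1 / m k)"
    using pos by (intro sum_mono divide_left_mono mono) auto
  finally have "weighted_tail m k \<le> 2 * real k / m k + ?S" by (simp add: weighted_tail_def)
  also have "2 * real k / m k = (2 * real k / m (2 * k)) * (m (2 * k) / m k)"
    using pos[of "2 * k"] by simp
  also have "\<dots> \<le> (2 * real k / m (2 * k)) * (C + C * (m (2 * k) / real (2 * k)) * ?S)"
    using pos[of "2 * k"] by (intro mult_left_mono[OF C]) (auto intro: less_imp_le)
  also have "\<dots> = C * weighted_tail m (2 * k)"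
    using pos[of "2 * k"] k by (simp add: weighted_tail_def field_simps)
  finally show ?thesis
    using weighted_tail_ge(3)[OF pos sm, of "2 * k"] by (simp add: algebra_simps)
qed

section \<open>The kernel of a weight sequence\<close>

text \<open>The kernel is $\kappa(t) = \left((1 + t^{1/r})^2 \prod_{j \ge 0} (1 + t^{1/r}/\mu_j)\right)^{-r}$, and \<open>N\<^sub>n\<close> stands for
  $\prod_{j<n} \mu_j^r$. The two additional factors supply the decay $(1 + |t|)^{-2}$, without which
  the estimates would involve $N_{n+2}$ in place of $N_n$. The moment of order \<open>p\<close> is bounded
  from below, up to a geometric factor, by the value of the integrand at $t = l_p^r$: for the factors of index $j < p$ one has
  $1 + l_p/\mu_j \le (1 + T)\, l_p/l_j$, and the remaining ones contribute at most $e^{T(p+1)}$.\<close>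
lemma cutoffs_exist:
  fixes \<mu> l :: "nat \<Rightarrow> real" and r G T :: real
  assumes r: "r > 0" and \<mu>: "\<And>j. \<mu> j \<ge> 1" and sm: "summable (\<lambda>j. 1 / \<mu> j)"
    and l1: "\<And>j. l j \<ge> 1" and mono: "\<And>i j. i \<le> j \<Longrightarrow> l i \<le> l j"
    and T: "T \<ge> 0" and l\<mu>: "\<And>j. l j \<le> T * \<mu> j"
    and tail: "\<And>p. l p * (\<Sum>j. 1 / \<mu> (j + p)) \<le> T * real (Suc p)"
    and G: "G > 0" and growth: "\<And>p. l p powr r \<le> G ^ Suc p"
  shows "\<exists>\<Phi> m B C0. B > 0 \<and> C0 > 0 \<and> (\<forall>p. \<Phi> p holomorphic_on sector r) \<and>
     (\<forall>p n s. n \<le> p \<longrightarrow> s \<in> sector r \<longrightarrow>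
        norm (\<Phi> p s) \<le> 4 * (\<Prod>j<n. \<mu> j powr r) * exp ((real p - real n) * Re s)) \<and>
     (\<forall>p n s. p < n \<longrightarrow> s \<in> sector r \<longrightarrow>
        norm (m p - \<Phi> p s) \<le> 4 * (\<Prod>j<n. \<mu> j powr r) * exp ((real p - real n) * Re s)) \<and>
     (\<forall>p. (\<Prod>j<p. l j powr r) \<le> C0 * B ^ p * norm (m p))"
proof -
  define b where "b j = (if j < 2 then 1 else 1 / \<mu> (j - 2))" for j
  have \<mu>0: "\<mu> j > 0" and l0: "l j > 0" for j using \<mu>[of j] l1[of j] by linarith+
  have b: "b j > 0" "b j \<le> 1" for j using \<mu>0 \<mu> by (auto simp: b_def)
  have b2: "b (Suc (Suc j)) = 1 / \<mu> j" for j by (simp add: b_def)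
  have smb: "summable b"
    using summable_iff_shift[of b 2] sm by (simp add: b2)
  define N where "N n = (\<Prod>j<n. \<mu> j powr r)" for n
  have N: "N n > 0" for n unfolding N_def by (intro prod_pos) (simp add: less_imp_neq[OF \<mu>0, symmetric])
  \<comment> \<open>The index is shifted by the two factors with \<open>b j = 1\<close>.\<close>
  have expN: "exp (- r * (\<Sum>j<n + 2. ln (b j))) = N n" for n
  proof (induction n)
    case (Suc n)
    have "- r * (\<Sum>j<Suc n + 2. ln (b j)) = - r * (\<Sum>j<n + 2. ln (b j)) + r * ln (\<mu> n)"
      using \<mu>0[of n] by (simp add: b2 ln_div algebra_simps)
    then have "exp (- r * (\<Sum>j<Suc n + 2. ln (b j))) = N n * exp (r * ln (\<mu> n))"
      by (simp only: exp_add Suc)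
    also have "\<dots> = N (Suc n)"
      using \<mu>0[of n] by (simp add: N_def powr_def)
    finally show ?case .
  qed (simp add: N_def b_def lessThan_Suc numeral_2_eq_2)
  define \<kappa> where "\<kappa> s = exp (- of_real r * log_prod b (exp (s / of_real r)))" for s
  define k where "k x = exp (- r * (\<Sum>j. ln (1 + exp (x / r) * b j)))" for x
  have Re_pos: "Re (exp (s / of_real r)) > 0" if "s \<in> sector r" for s
  proof -
    have "- (pi / 2) < Im s / r" "Im s / r < pi / 2"
      using that r by (auto simp: sector_def field_simps)
    then have "cos (Im s / r) > 0" by (rule cos_gt_zero_pi)
    then show ?thesis using r by (simp add: Re_exp)
  qed
  have hol: "\<kappa> holomorphic_on sector r"
  proof -
    have "(log_prod b \<circ> (\<lambda>s. exp (s / of_real r))) holomorphic_on sector r"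
      using Re_pos r by (intro holomorphic_on_compose_gen[OF _ holomorphic_log_prod[OF b(1) smb]])
        (auto intro!: holomorphic_intros)
    then have "(\<lambda>s. log_prod b (exp (s / of_real r))) holomorphic_on sector r" by (simp add: o_def)
    then show ?thesis unfolding \<kappa>_def by (intro holomorphic_intros)
  qed
  have \<kappa>_le: "norm (\<kappa> s) \<le> exp (- real n * Re s) * exp (- r * (\<Sum>j<n. ln (b j)))"
    if s: "s \<in> sector r" for s n
  proof -
    have "ln (norm (exp (s / of_real r)) * b j) = Re s / r + ln (b j)" for j
      using b(1)[of j] r by (simp add: ln_mult)
    then have "real n * (Re s / r) + (\<Sum>j<n. ln (b j)) \<le> Re (log_prod b (exp (s / of_real r)))"
      using Re_log_prod_ge[OF b(1) smb Re_pos[OF s], of n] by (simp add: sum.distrib)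
    then have "- r * Re (log_prod b (exp (s / of_real r))) \<le> - r * (real n * (Re s / r) + (\<Sum>j<n. ln (b j)))"
      using r by (intro mult_left_mono_neg) auto
    also have "\<dots> = - real n * Re s + - r * (\<Sum>j<n. ln (b j))"
      using r by (simp add: algebra_simps)
    finally have "- r * Re (log_prod b (exp (s / of_real r))) \<le> - real n * Re s + - r * (\<Sum>j<n. ln (b j))" .
    then show ?thesis
      by (simp add: \<kappa>_def mult_exp_exp del: mult_minus_left)
  qed
  have bound: "norm (\<kappa> s) \<le> (4 * N n) * exp (- real n * Re s) / (1 + exp (Re s))\<^sup>2"
    if s: "s \<in> sector r" for s n
  proof -
    have "norm (\<kappa> s) * (1 + exp (Re s))\<^sup>2 \<le> N n * exp (- real n * Re s) * 4"
    proof (cases "Re s \<ge> 0")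
      case True
      have "(1 + exp (Re s))\<^sup>2 \<le> (2 * exp (Re s))\<^sup>2"
        using True by (intro power_mono) auto
      then have le: "(1 + exp (Re s))\<^sup>2 \<le> 4 * exp (2 * Re s)"
        by (simp add: power2_eq_square mult_exp_exp)
      have "norm (\<kappa> s) \<le> exp (- real (n + 2) * Re s) * N n"
        using \<kappa>_le[OF s, of "n + 2"] by (simp only: expN)
      then have "norm (\<kappa> s) * (1 + exp (Re s))\<^sup>2 \<le> exp (- real (n + 2) * Re s) * N n * (4 * exp (2 * Re s))"
        using le N[of n] by (intro mult_mono) auto
      also have "\<dots> = N n * exp (- real n * Re s) * 4"
        by (simp add: mult_exp_exp algebra_simps)
      finally show ?thesis .
    next
      case False
      have "(1 + exp (Re s))\<^sup>2 \<le> 2\<^sup>2"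
        using False by (intro power_mono) (auto simp: add_nonneg_nonneg)
      then have le: "(1 + exp (Re s))\<^sup>2 \<le> 4" by simp
      have "ln (b j) \<le> 0" for j using b[of j] by simp
      then have "(\<Sum>j<n + 2. ln (b j)) \<le> (\<Sum>j<n. ln (b j))"
        using add_mono[of "ln (b n)" 0 "ln (b (Suc n))" 0] by simp
      then have "- r * (\<Sum>j<n. ln (b j)) \<le> - r * (\<Sum>j<n + 2. ln (b j))"
        using r by (intro mult_left_mono_neg) auto
      then have "exp (- r * (\<Sum>j<n. ln (b j))) \<le> N n"
        unfolding expN[symmetric] by (simp only: exp_le_cancel_iff)
      then have "norm (\<kappa> s) \<le> exp (- real n * Re s) * N n"
        using \<kappa>_le[OF s, of n] by (smt (verit) exp_gt_zero mult_left_mono)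
      then have "norm (\<kappa> s) * (1 + exp (Re s))\<^sup>2 \<le> exp (- real n * Re s) * N n * 4"
        using le N[of n] by (intro mult_mono) auto
      then show ?thesis by (simp add: mult_ac)
    qed
    moreover have "(1 + exp (Re s))\<^sup>2 > 0" by (smt (verit) exp_gt_zero zero_less_power)
    ultimately show ?thesis by (simp add: pos_le_divide_eq mult_ac)
  qed
  have real: "\<kappa> (of_real x) = of_real (k x)" for x
  proof -
    have eq: "exp (of_real x / of_real r) = (of_real (exp (x / r)) :: complex)"
      by (simp add: exp_of_real[symmetric])
    show ?thesis
      unfolding \<kappa>_def k_def eq log_prod_of_real[OF b(1) smb exp_gt_zero]
      by (simp add: exp_of_real[symmetric])
  qed
  have anti: "k y \<le> k x" if "x \<le> y" for x y
  proof -
    have "exp (x / r) \<le> exp (y / r)" using that r by (simp add: divide_right_mono)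
    then have "(\<Sum>j. ln (1 + exp (x / r) * b j)) \<le> (\<Sum>j. ln (1 + exp (y / r) * b j))"
      by (intro suminf_ln_one_plus_mono[OF b(1) smb]) auto
    then show ?thesis using r by (simp add: k_def)
  qed
  have "\<exists>\<Phi> m. \<Phi> holomorphic_on sector r \<and>
     (\<forall>n s. n \<le> p \<longrightarrow> s \<in> sector r \<longrightarrow> norm (\<Phi> s) \<le> 4 * N n * exp ((real p - real n) * Re s)) \<and>
     (\<forall>n s. p < n \<longrightarrow> s \<in> sector r \<longrightarrow> norm (m - \<Phi> s) \<le> 4 * N n * exp ((real p - real n) * Re s)) \<and>
     (\<forall>x. exp ((x - 1) * (real p + 1)) * k x \<le> norm m)" for p
    by (rule cutoff_exists[where D = "\<lambda>n. 4 * N n", OF r hol _ bound real _ anti])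
       (auto simp: N k_def)
  then obtain \<Phi> m where \<Phi>: "\<And>p. \<Phi> p holomorphic_on sector r"
     "\<And>p n s. n \<le> p \<Longrightarrow> s \<in> sector r \<Longrightarrow> norm (\<Phi> p s) \<le> 4 * N n * exp ((real p - real n) * Re s)"
     "\<And>p n s. p < n \<Longrightarrow> s \<in> sector r \<Longrightarrow> norm (m p - \<Phi> p s) \<le> 4 * N n * exp ((real p - real n) * Re s)"
     and mass: "\<And>p x. exp ((x - 1) * (real p + 1)) * k x \<le> norm (m p)"
    by metis
  define B where "B = exp 1 * G * exp (r * (ln (1 + T) + T))"
  define C0 where "C0 = exp 1 * G * exp (r * (2 * ln 2 + T))"
  have "(\<Prod>j<p. l j powr r) \<le> C0 * B ^ p * norm (m p)" for p
  proof -
    define x where "x = l p"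
    have x: "x > 0" "x \<ge> 1" using l0 l1 by (auto simp: x_def)
    define S where "S = (\<Sum>j<p. ln (l j))"
    have prodl: "(\<Prod>j<p. l j powr r) = exp (r * S)"
      using l0 by (simp add: S_def sum_distrib_left exp_sum powr_def less_imp_neq[symmetric] mult.commute)
    have "(\<Sum>j. ln (1 + x * b j)) \<le> (\<Sum>j<p + 2. ln (1 + x * b j)) + x * (\<Sum>j. b (j + (p + 2)))"
      by (rule suminf_ln_one_plus_le[OF b(1) smb x(1)])
    also have "x * (\<Sum>j. b (j + (p + 2))) \<le> T * (real p + 1)"
      using tail[of p] by (simp add: x_def b2 algebra_simps)
    also have "(\<Sum>j<p + 2. ln (1 + x * b j)) = 2 * ln (1 + x) + (\<Sum>j<p. ln (1 + x * (1 / \<mu> j)))"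
      using sum.lessThan_Suc_shift[of "\<lambda>j. ln (1 + x * b j)" "Suc p"]
        sum.lessThan_Suc_shift[of "\<lambda>j. ln (1 + x * b (Suc j))" p]
      by (simp add: b2) (simp add: b_def)
    also have "2 * ln (1 + x) \<le> 2 * (ln 2 + ln x)"
    proof -
      have "ln (1 + x) \<le> ln (2 * x)" using x by (intro ln_mono) auto
      then show ?thesis using x by (simp add: ln_mult)
    qed
    also have "(\<Sum>j<p. ln (1 + x * (1 / \<mu> j))) \<le> (\<Sum>j<p. ln x + ln (1 + T) - ln (l j))"
    proof (rule sum_mono)
      fix j assume "j \<in> {..<p}"
      then have "l j \<le> x" by (auto simp: x_def intro: mono)
      then have "1 \<le> x / l j" using l0[of j] by simp
      moreover have "1 / \<mu> j \<le> T / l j" using l\<mu>[of j] l0[of j] \<mu>0[of j] by (simp add: field_simps)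
      then have "x * (1 / \<mu> j) \<le> x * (T / l j)" using x by (intro mult_left_mono) auto
      ultimately have "1 + x * (1 / \<mu> j) \<le> x * (1 + T) / l j"
        by (simp add: ring_distribs add_divide_distrib)
      then have "ln (1 + x * (1 / \<mu> j)) \<le> ln (x * (1 + T) / l j)"
        using x \<mu>0[of j] by (intro ln_mono) (auto intro: add_pos_nonneg)
      then show "ln (1 + x * (1 / \<mu> j)) \<le> ln x + ln (1 + T) - ln (l j)"
        using x T l0[of j] by (simp add: ln_mult ln_div)
    qed
    also have "\<dots> = real p * (ln x + ln (1 + T)) - S"
      by (simp add: sum_subtractf S_def)
    finally have "(\<Sum>j. ln (1 + x * b j)) \<le>
        2 * (ln 2 + ln x) + (real p * (ln x + ln (1 + T)) - S) + T * (real p + 1)" by simp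
    then have "- r * (\<Sum>j. ln (1 + x * b j)) \<ge>
        - r * (2 * (ln 2 + ln x) + (real p * (ln x + ln (1 + T)) - S) + T * (real p + 1))"
      using r by (intro mult_left_mono_neg) auto
    then have "exp ((r * ln x - 1) * (real p + 1)) *
        exp (- r * (2 * (ln 2 + ln x) + (real p * (ln x + ln (1 + T)) - S) + T * (real p + 1)))
        \<le> exp ((r * ln x - 1) * (real p + 1)) * k (r * ln x)"
      using r x by (intro mult_left_mono) (auto simp: k_def)
    also have "\<dots> \<le> norm (m p)" by (rule mass)
    finally have "exp (r * S) * exp (- (real p + 1) - r * ln x - r * (2 * ln 2 + T)
        - real p * (r * (ln (1 + T) + T))) \<le> norm (m p)"
      by (simp add: mult_exp_exp algebra_simps)
    then have "exp (r * S) \<le> norm (m p) * exp (real p + 1 + r * ln x + r * (2 * ln 2 + T)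
        + real p * (r * (ln (1 + T) + T)))"
      by (simp add: exp_diff exp_minus exp_add field_simps)
    also have "\<dots> = norm (m p) * (exp 1 ^ Suc p * exp (r * ln x) * exp (r * (2 * ln 2 + T))
        * exp (r * (ln (1 + T) + T)) ^ p)"
      by (simp add: exp_of_nat_mult[symmetric] exp_add mult_ac)
    also have "\<dots> \<le> norm (m p) * (exp 1 ^ Suc p * G ^ Suc p * exp (r * (2 * ln 2 + T))
        * exp (r * (ln (1 + T) + T)) ^ p)"
      using growth[of p] x G by (intro mult_left_mono mult_right_mono) (auto simp: powr_def x_def)
    also have "\<dots> = C0 * B ^ p * norm (m p)"
      by (simp add: B_def C0_def power_mult_distrib mult_ac)
    finally show ?thesis by (simp add: prodl)
  qed
  moreover have "B > 0" "C0 > 0" using G by (simp_all add: B_def C0_def)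
  ultimately show ?thesis using \<Phi> unfolding N_def by blast
qed

section \<open>The maximal sequence\<close>

text \<open>The quotients are at least \<open>1\<close>, so convergence for one exponent passes to all smaller ones.\<close>
lemma summable_below_quasianalyticity_order:
  assumes N: "N \<in> LC" and r: "0 < r" "ennreal r < quasianalyticity_order N"
  shows "summable (\<lambda>k. 1 / quot N k powr (1 / r))"
proof -
  obtain s where s: "s > 0" "ennreal r < ennreal s" and sm: "summable (\<lambda>k. (1 / quot N (Suc k)) powr (1 / s))"
    using r(2) unfolding quasianalyticity_order_def less_Sup_iff by auto
  have rs: "r < s" using s r by (simp add: ennreal_less_iff)
  have ge1: "quot N (Suc k) \<ge> 1" for k
    by (induction k) (use LC_quot(2,3)[OF N] order_trans in blast)+
  have "summable (\<lambda>k. 1 / quot N (Suc k) powr (1 / r))"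
  proof (rule summable_comparison_test'[OF sm])
    fix k
    have "1 / s \<le> 1 / r" using rs r by (intro divide_left_mono) auto
    then have "(1 / quot N (Suc k)) powr (1 / r) \<le> (1 / quot N (Suc k)) powr (1 / s)"
      using ge1[of k] by (intro powr_mono') auto
    then show "norm (1 / quot N (Suc k) powr (1 / r)) \<le> (1 / quot N (Suc k)) powr (1 / s)"
      using ge1[of k] by (simp add: powr_divide)
  qed
  then show ?thesis using summable_Suc_iff[of "\<lambda>k. 1 / quot N k powr (1 / r)"] by simp
qed

theorem theorem6p2:
  fixes N :: "nat \<Rightarrow> real" and r :: real
  assumes "N \<in> LC"
    and "quasianalyticity_order N > 0"
    and "0 < r" and "ennreal r < quasianalyticity_order N"
    and "\<exists>C\<ge>1. \<forall>k\<ge>1.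
           quot N (2 * k) powr (1 / r) / quot N k powr (1 / r)
             \<le> C + C * (quot N (2 * k) powr (1 / r) / real (2 * k))
                   * (\<Sum>j. 1 / quot N (j + 2 * k) powr (1 / r))"
  shows "\<exists>L\<in>LC. mg L \<and>
     (\<forall>\<gamma>. 0 < \<gamma> \<and> \<gamma> < r \<longrightarrow>
        (\<exists>k1>0. \<forall>h>0. \<exists>E.
           linear_continuous (hat L) h (hat N) (k1 * h) (sector \<gamma>) E \<and>
           (\<forall>a\<in>Lambda_space (hat L) h. has_borel_image \<gamma> (E a) a)) \<and>
        Lambda_union (hat L) \<subseteq> borel_map \<gamma> ` ultra_union (hat N) (sector \<gamma>)) \<and>
     (\<exists>C'\<ge>1. \<forall>k. quot L k \<le> C' * quot N k) \<and>
     gamma_cond L N r \<and>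
     (\<forall>M\<in>LC. (\<exists>C'\<ge>1. \<forall>k. quot M k \<le> C' * quot N k) \<and> gamma_cond M N r \<longrightarrow>
        (\<exists>D\<ge>1. \<forall>k. quot M k \<le> D * quot L k))"
proof -
  note r = assms(3)
  define m where "m k = quot N k powr (1 / r)" for k
  note N = LC_quot[OF assms(1)]
  have m0: "m k > 0" for k using N(1)[of k] unfolding m_def by (subst powr_gt_zero) auto
  have m_powr: "m k powr r = quot N k" for k
    using N(1)[of k] r by (simp add: m_def powr_powr)
  have m_inv: "(1 / quot N k) powr (1 / r) = 1 / m k" for k
    using N(1)[of k] by (simp add: m_def powr_divide)
  have m_Suc: "m (Suc j) \<le> m (Suc (Suc j))" for j
    unfolding m_def using N(1)[of "Suc j"] N(3)[of j] r by (intro powr_mono2) auto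
  have m_mono: "m k \<le> m j" if "1 \<le> k" "k \<le> j" for k j
    using lift_Suc_mono_le[of "\<lambda>j. m (Suc j)", OF m_Suc, of "k - 1" "j - 1"] that by simp
  have m1: "m (Suc j) \<ge> 1" for j
    using m_mono[of 1 "Suc j"] ge_one_powr_ge_zero[of "quot N 1" "1 / r"] N(2) r by (simp add: m_def)
  have sm: "summable (\<lambda>j. 1 / m j)"
    unfolding m_def by (rule summable_below_quasianalyticity_order[OF assms(1) r assms(4)])
  obtain C where C: "C \<ge> 1"
    and Cle: "\<And>k. k \<ge> 1 \<Longrightarrow> m (2 * k) / m k \<le> C + C * (m (2 * k) / real (2 * k)) * (\<Sum>j. 1 / m (j + 2 * k))"
    using assms(5) unfolding m_def by blast
  note tail0 = weighted_tail_ge[of m, OF m0 sm]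
  have tail_Suc: "weighted_tail m (Suc (Suc j)) \<le> weighted_tail m (Suc j)" for j
    by (rule weighted_tail_Suc_le[OF m0 sm m_Suc])
  have tail_anti: "weighted_tail m (Suc j) \<le> weighted_tail m (Suc i)" if "i \<le> j" for i j
    by (rule lift_Suc_antimono_le[of "\<lambda>j. weighted_tail m (Suc j)", OF tail_Suc that])
  have tail_dbl: "weighted_tail m k \<le> (C + 1) * weighted_tail m (2 * k)" if "k \<ge> 1" for k
    using m_mono that by (intro weighted_tail_le_double[OF m0 sm _ that Cle]) auto
  define T where "T = weighted_tail m 1"
  have T: "T > 0" unfolding T_def by (rule tail0)
  \<comment> \<open>The \<open>r\<close>-th roots of the quotients of \<open>L\<close>, normalised so that \<open>l 1 = 1\<close>.\<close>
  define l where "l k = T * real k / weighted_tail m k" for k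
  have l_ge: "l (Suc j) \<ge> real (Suc j)" for j
    using tail_anti[of 0 j] tail0(1)[of "Suc j"] unfolding l_def T_def
    by (simp add: pos_le_divide_eq mult.commute mult_left_mono del: of_nat_Suc)
  have l1: "l (Suc j) \<ge> 1" for j by (rule order_trans[OF _ l_ge]) simp
  have l0: "l (Suc j) > 0" for j using l1[of j] by linarith
  have l_mono: "l (Suc i) \<le> l (Suc j)" if "i \<le> j" for i j
    unfolding l_def using that tail_anti[OF that] tail0(1) T by (intro frac_le mult_left_mono) auto
  have lm: "l k \<le> T * m k" for k
  proof -
    have "real k \<le> m k * weighted_tail m k"
      using tail0(2)[of k] m0[of k] by (simp add: pos_divide_le_eq mult.commute)
    then show ?thesis
      using tail0(1)[of k] T by (simp add: l_def pos_divide_le_eq mult_left_mono mult.assoc)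
  qed
  have l_tail: "l k * (\<Sum>j. 1 / m (j + k)) \<le> T * real k" for k
  proof -
    have "T * real k * (\<Sum>j. 1 / m (j + k)) \<le> T * real k * weighted_tail m k"
      using tail0(3)[of k] T by (intro mult_left_mono) auto
    then show ?thesis using tail0(1)[of k] by (simp add: l_def pos_divide_le_eq)
  qed
  have l_dbl: "l (2 * k) \<le> 2 * (C + 1) * l k" if "k \<ge> 1" for k
  proof -
    have "2 * T * real k * weighted_tail m k \<le> 2 * T * real k * ((C + 1) * weighted_tail m (2 * k))"
      using T by (intro mult_left_mono tail_dbl that) auto
    then show ?thesis
      using tail0(1)[of k] tail0(1)[of "2 * k"] by (simp add: l_def field_simps)
  qed
  define L where "L n = (\<Prod>j<n. l (Suc j) powr r)" for n
  have lr0: "l (Suc j) powr r > 0" for j using l0[of j] by (subst powr_gt_zero) auto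
  have lr_mono: "l (Suc j) powr r \<le> l (Suc (Suc j)) powr r" for j
    using l_mono[of j "Suc j"] l0[of j] r by (intro powr_mono2) auto
  have quotL: "quot L (Suc k) = l (Suc k) powr r" for k
    unfolding L_def[abs_def] by (rule quot_prod[of "\<lambda>k. l k powr r", OF lr0])
  have L_LC: "L \<in> LC"
    unfolding L_def[abs_def]
    by (rule prod_in_LC[of r "\<lambda>k. l k powr r", OF r lr_mono])
       (use l_ge r in \<open>auto intro!: powr_mono2 simp del: of_nat_Suc\<close>)
  define A where "A = (2 * (C + 1)) powr r"
  have A: "A \<ge> 1" unfolding A_def using C r by (intro ge_one_powr_ge_zero) auto
  have L_mg: "L (j + k) \<le> A ^ (j + k) * L j * L k" for j k
    unfolding L_def
  proof (rule prod_mg[of "\<lambda>k. l k powr r", OF lr0 lr_mono A])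
    fix k :: nat assume k: "k \<ge> 1"
    have "l (2 * k) powr r \<le> (2 * (C + 1) * l k) powr r"
      using l_dbl[OF k] l0[of "2 * k - 1"] k r by (intro powr_mono2) auto
    also have "\<dots> = A * l k powr r"
      using C l0[of "k - 1"] k by (simp add: A_def powr_mult)
    finally show "l (2 * k) powr r \<le> A * l k powr r" .
  qed
  have L_pos: "L k > 0" for k unfolding L_def using lr0 by (intro prod_pos) auto
  \<comment> \<open>Moderate growth with \<open>l 1 = 1\<close> makes the quotients of \<open>L\<close> at most geometric.\<close>
  have growth: "l (Suc p) powr r \<le> A ^ Suc p" for p
  proof -
    have "l 1 = 1" using T by (simp add: l_def T_def)
    then have "L (Suc p) \<le> A ^ Suc p * L p"
      using L_mg[of p 1] by (simp add: L_def mult_ac)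
    then show ?thesis using L_pos[of p] by (simp add: L_def mult_ac)
  qed
  have "\<exists>\<Phi> mm B C0. B > 0 \<and> C0 > 0 \<and> (\<forall>p. \<Phi> p holomorphic_on sector r) \<and>
     (\<forall>p n s. n \<le> p \<longrightarrow> s \<in> sector r \<longrightarrow>
        norm (\<Phi> p s) \<le> 4 * (\<Prod>j<n. m (Suc j) powr r) * exp ((real p - real n) * Re s)) \<and>
     (\<forall>p n s. p < n \<longrightarrow> s \<in> sector r \<longrightarrow>
        norm (mm p - \<Phi> p s) \<le> 4 * (\<Prod>j<n. m (Suc j) powr r) * exp ((real p - real n) * Re s)) \<and>
     (\<forall>p. (\<Prod>j<p. l (Suc j) powr r) \<le> C0 * B ^ p * norm (mm p))"
  proof (rule cutoffs_exist[where T = T and G = A])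
    show "summable (\<lambda>j. 1 / m (Suc j))" using sm summable_Suc_iff[of "\<lambda>j. 1 / m j"] by simp
    show "l (Suc p) * (\<Sum>j. 1 / m (Suc (j + p))) \<le> T * real (Suc p)" for p
      using l_tail[of "Suc p"] by simp
    show "l (Suc i) \<le> l (Suc j)" if "i \<le> j" for i j by (rule l_mono[OF that])
    show "0 \<le> T" "0 < A" using T A by simp_all
  qed (rule r m1 l1 lm growth)+
  then obtain \<Phi> mm B C0 where \<Phi>: "B > 0" "C0 > 0" "\<And>p. \<Phi> p holomorphic_on sector r"
     "\<And>p n s. n \<le> p \<Longrightarrow> s \<in> sector r \<Longrightarrow> norm (\<Phi> p s) \<le> 4 * N n * exp ((real p - real n) * Re s)"
     "\<And>p n s. p < n \<Longrightarrow> s \<in> sector r \<Longrightarrow> norm (mm p - \<Phi> p s) \<le> 4 * N n * exp ((real p - real n) * Re s)"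
     "\<And>p. L p \<le> C0 * B ^ p * norm (mm p)"
    unfolding m_powr N(4)[symmetric] L_def[symmetric] by metis
  have N_pos: "N n > 0" for n using assms(1) by (simp add: LC_def)
  have ext: "\<exists>k1>0. \<forall>h>0. \<exists>E.
           linear_continuous (hat L) h (hat N) (k1 * h) (sector \<gamma>) E \<and>
           (\<forall>a\<in>Lambda_space (hat L) h. has_borel_image \<gamma> (E a) a)" if "0 < \<gamma>" "\<gamma> < r" for \<gamma>
    by (rule extension_operator[where C = 4 and r = r, OF that L_pos N_pos _ \<Phi>(1,2,3,4,5,6)]) auto
  have union: "Lambda_union (hat L) \<subseteq> borel_map \<gamma> ` ultra_union (hat N) (sector \<gamma>)" if \<gamma>: "0 < \<gamma>" "\<gamma> < r" for \<gamma>
  proof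
    fix a assume "a \<in> Lambda_union (hat L)"
    then obtain h where h: "h > 0" and a: "a \<in> Lambda_space (hat L) h"
      by (auto simp: Lambda_union_def)
    obtain k1 E where k1: "k1 > 0" and E: "linear_continuous (hat L) h (hat N) (k1 * h) (sector \<gamma>) E"
      and bor: "has_borel_image \<gamma> (E a) a"
      using ext[OF \<gamma>] h a by blast
    have "E a \<in> ultra_space (hat N) (k1 * h) (sector \<gamma>)"
      using E a by (simp add: linear_continuous_def)
    then have "E a \<in> ultra_union (hat N) (sector \<gamma>)"
      using k1 h by (auto simp: ultra_union_def)
    then show "a \<in> borel_map \<gamma> ` ultra_union (hat N) (sector \<gamma>)"
      using borel_map_eqI[OF \<gamma>(1) bor] by (metis imageI)
  qed
  have q0: "quot X 0 = 1" for X by (simp add: quot_def)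
  have dominated: "\<exists>C'\<ge>1. \<forall>k. quot L k \<le> C' * quot N k"
  proof (intro exI[of _ "max 1 (T powr r)"] conjI allI)
    fix k
    show "quot L k \<le> max 1 (T powr r) * quot N k"
    proof (cases k)
      case (Suc j)
      have "quot L k \<le> (T * m k) powr r"
        using lm[of k] l0[of j] r unfolding Suc quotL by (intro powr_mono2) auto
      also have "\<dots> = T powr r * quot N k"
        using T m0[of k] by (simp add: powr_mult m_powr)
      also have "\<dots> \<le> max 1 (T powr r) * quot N k"
        using N(1)[of k] by (intro mult_right_mono) auto
      finally show ?thesis .
    qed (simp add: q0)
  qed simp
  have gammaL: "gamma_cond L N r"
    unfolding gamma_cond_def m_inv
  proof (intro conjI allI impI bdd_aboveI2)
    show "summable (\<lambda>k. 1 / m (k + p))" for p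
      using sm by (rule summable_ignore_initial_segment)
    fix p :: nat assume "p \<in> {1..}"
    then obtain j where p: "p = Suc j" by (cases p) auto
    have "quot L p powr (1 / r) = l p"
      using l0[of j] r unfolding p quotL by (simp add: powr_powr)
    then show "quot L p powr (1 / r) / real p * (\<Sum>k. 1 / m (k + p)) \<le> T"
      using l_tail[of p] p by (simp add: field_simps del: of_nat_Suc)
  qed
  have maximal: "\<exists>D\<ge>1. \<forall>k. quot M k \<le> D * quot L k"
    if M: "M \<in> LC" and C': "C' \<ge> 1" "\<And>k. quot M k \<le> C' * quot N k" and g: "gamma_cond M N r" for M C'
  proof -
    obtain Q where Q: "\<And>p. p \<ge> 1 \<Longrightarrow> quot M p powr (1 / r) / real p * (\<Sum>k. 1 / m (k + p)) \<le> Q"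
      using g unfolding gamma_cond_def m_inv bdd_above_def by auto
    define D where "D = (C' powr (1 / r) + \<bar>Q\<bar>) / T"
    have D0: "D \<ge> 0" using T by (simp add: D_def)
    have "quot M (Suc j) \<le> max 1 (D powr r) * quot L (Suc j)" for j
    proof -
      let ?p = "Suc j"
      define x where "x = quot M ?p powr (1 / r)"
      have x0: "x \<ge> 0" by (simp add: x_def)
      have "x \<le> (C' * quot N ?p) powr (1 / r)"
        unfolding x_def using C'(2)[of ?p] LC_quot(1)[OF M, of ?p] r by (intro powr_mono2) auto
      then have 1: "x \<le> C' powr (1 / r) * m ?p"
        using C' N(1)[of ?p] by (simp add: powr_mult m_def)
      have "x * (\<Sum>k. 1 / m (k + ?p)) \<le> Q * real ?p"
        using Q[of ?p] by (simp add: x_def field_simps del: of_nat_Suc)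
      also have "\<dots> \<le> \<bar>Q\<bar> * real ?p" by (intro mult_right_mono) auto
      finally have 2: "x * (\<Sum>k. 1 / m (k + ?p)) \<le> \<bar>Q\<bar> * real ?p" .
      have "x * weighted_tail m ?p = x / m ?p * real ?p + x * (\<Sum>k. 1 / m (k + ?p))"
        by (simp add: weighted_tail_def algebra_simps)
      also have "\<dots> \<le> C' powr (1 / r) * real ?p + \<bar>Q\<bar> * real ?p"
        using 1 m0[of ?p] by (intro add_mono 2 mult_right_mono) (auto simp: pos_divide_le_eq)
      finally have "x * weighted_tail m ?p \<le> (C' powr (1 / r) + \<bar>Q\<bar>) * real ?p"
        by (simp add: distrib_right)
      then have "x \<le> D * l ?p"
        using tail0(1)[of ?p] T by (simp add: D_def l_def pos_le_divide_eq del: of_nat_Suc)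
      then have "x powr r \<le> (D * l ?p) powr r"
        using x0 r by (intro powr_mono2) auto
      also have "x powr r = quot M ?p"
        using LC_quot(1)[OF M, of ?p] r by (simp add: x_def powr_powr)
      also have "(D * l ?p) powr r = D powr r * quot L ?p"
        using D0 l0[of j] by (simp add: powr_mult quotL)
      also have "\<dots> \<le> max 1 (D powr r) * quot L ?p"
        using lr0[of j] by (intro mult_right_mono) (auto simp: quotL)
      finally show ?thesis .
    qed
    then have "quot M k \<le> max 1 (D powr r) * quot L k" for k
      by (cases k) (auto simp: q0)
    then show ?thesis by (intro exI[of _ "max 1 (D powr r)"]) auto
  qed
  have "mg L" unfolding mg_def using A L_mg by blast
  show ?thesis
  proof (intro bexI[of _ L] conjI allI impI ballI)
    fix \<gamma> assume "0 < \<gamma> \<and> \<gamma> < r"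
    then show "\<exists>k1>0. \<forall>h>0. \<exists>E.
           linear_continuous (hat L) h (hat N) (k1 * h) (sector \<gamma>) E \<and>
           (\<forall>a\<in>Lambda_space (hat L) h. has_borel_image \<gamma> (E a) a)"
      and "Lambda_union (hat L) \<subseteq> borel_map \<gamma> ` ultra_union (hat N) (sector \<gamma>)"
      using ext union by simp_all
  next
    fix M assume "M \<in> LC" "(\<exists>C'\<ge>1. \<forall>k. quot M k \<le> C' * quot N k) \<and> gamma_cond M N r"
    then show "\<exists>D\<ge>1. \<forall>k. quot M k \<le> D * quot L k"
      using maximal by metis
  qed fact+
qed

end
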